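(* Let $q\in(0,1)$ and let $a,b,c,d\in\mathbb{C}^*$ be generic. For every $U\in\mathcal{H}_{a,b,c,d}$ (the double affine Hecke algebra of type $\check{C_1}C_1$), with $\pi$ the basic representation and $t_4$ the isomorphism described in the context, one has $$\frac{G_c(Z)}{G_{qd^{-1}}(Z)}\,\pi_{a,b,c,d}(U)\,\frac{G_{qd^{-1}}(Z)}{G_c(Z)}=\pi_{a,b,qd^{-1},qc^{-1}}(t_4(U)).$$ In particular, $$\frac{G_c(Z)}{G_{qd^{-1}}(Z)}\,T_0(c,d)\,\frac{G_{qd^{-1}}(Z)}{G_c(Z)}=q^{-1}cd\,T_0(qd^{-1},qc^{-1}).$$ Hence also $$\frac{G_c(Z)}{G_{qd^{-1}}(Z)}\,Y(a,b,c,d)\,\frac{G_{qd^{-1}}(Z)}{G_c(Z)}=q^{-1}cd\,Y(a,b,qd^{-1},qc^{-1}),$$ $$\frac{G_c(Z)}{G_{qd^{-1}}(Z)}\,D(a,b,c,d)\,\frac{G_{qd^{-1}}(Z)}{G_c(Z)}=q^{-1}cd\,D(a,b,qd^{-1},qc^{-1}).$$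
   Context: $\mathbb{C}^*=\mathbb{C}\setminus\{0\}$, $q\in(0,1)$ fixed. $\mathcal{H}_{a,b,c,d}$ is the unital associative $\mathbb{C}$-algebra generated by $T_1,T_0,Z$ (with $Z$ invertible) with relations $(T_1+ab)(T_1+1)=0$, $(T_1Z+a)(T_1Z+b)=0$, $(qT_0Z^{-1}+c)(qT_0Z^{-1}+d)=0$, $(T_0+q^{-1}cd)(T_0+1)=0$. In it $T_1$ and $T_0$ are invertible; put $Y=T_1T_0$ and $D=Y+q^{-1}abcd\,Y^{-1}$. $t_4$ is the algebra isomorphism $\mathcal{H}_{a,b,c,d}\to\mathcal{H}_{a,b,qd^{-1},qc^{-1}}$ with $t_4(T_1)=T_1$, $t_4(T_0)=q^{-1}cd\,T_0$, $t_4(Z)=Z$. Basic representation $\pi_{a,b,c,d}$: $Z,T_1,T_0$ act as operators (on Laurent polynomials in $z$; the same formulas act on analytic functions on $\mathbb{C}^*$ and on meromorphic functions on $\mathbb{C}^*$, on which the operator identities are understood) by $(Zf)(z)=zf(z)$, $$(T_1f)(z)=-ab f(z)+z^{-1}(1-az)(1-bz)\frac{f(z)-f(z^{-1})}{z-z^{-1}},$$ $$(T_0f)(z)=-q^{-1}cd f(z)-z^{-1}(c-z)(d-z)\frac{f(z)-f(qz^{-1})}{z-qz^{-1}}.$$ The operator $T_0$ is written $T_0(c,d)$ to show parameter dependence, and $Y(a,b,c,d)$, $D(a,b,c,d)$ denote the operators $\pi_{a,b,c,d}(Y)$, $\pi_{a,b,c,d}(D)$. Gaussian: $G_e(z)=1/(ez,ez^{-1};q)_\infty$,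 where $(x_1,x_2;q)_\infty=\prod_{j\ge0}(1-x_1q^j)(1-x_2q^j)$; for a function $h$, $h(Z)$ denotes multiplication by $h(z)$. Generic: $a,b,c,d$ together with their inverses are all distinct. *)

theory Defs
  imports
    "HOL-Complex_Analysis.Complex_Analysis"
    "HOL-Library.Poly_Mapping"
    "HOL-Algebra.QuotRing"
begin

section \<open>The algebra by generators and relations\<close>

datatype gen = gT1 | gT0 | gZ | gZi

text \<open>
  The free monoid on the generators.  It is written additively because the convolution product
  of \<^type>\<open>poly_mapping\<close> is; \<open>word \<Rightarrow>\<^sub>0 complex\<close> is thus the free unital associative
  complex algebra on the generators.
\<close>

datatype word = Word (letters: "gen list")

instantiation word :: monoid_add
begin

definition zero_word :: word where "0 = Word []"

definition plus_word :: "word \<Rightarrow> word \<Rightarrow> word" where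
  "v + w = Word (letters v @ letters w)"

instance
  by standard (simp_all add: zero_word_def plus_word_def)

end

type_synonym free = "word \<Rightarrow>\<^sub>0 complex"

definition scal :: "complex \<Rightarrow> free" where
  "scal k = Poly_Mapping.single 0 k"

definition gn :: "gen \<Rightarrow> free" where
  "gn g = Poly_Mapping.single (Word [g]) 1"

definition free_alg :: "free ring" where
  "free_alg = \<lparr>carrier = UNIV, monoid.mult = (*), one = 1, zero = 0, add = (+)\<rparr>"

definition daha_rels :: "real \<Rightarrow> complex \<Rightarrow> complex \<Rightarrow> complex \<Rightarrow> complex \<Rightarrow> free set" where
  "daha_rels q a b c d =
    {(gn gT1 + scal (a * b)) * (gn gT1 + 1),
     (gn gT1 * gn gZ + scal a) * (gn gT1 * gn gZ + scal b),
     (scal q * gn gT0 * gn gZi + scal c) * (scal q * gn gT0 * gn gZi + scal d),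
     (gn gT0 + scal (inverse q * c * d)) * (gn gT0 + 1),
     gn gZ * gn gZi - 1,
     gn gZi * gn gZ - 1}"

definition daha_ideal :: "real \<Rightarrow> complex \<Rightarrow> complex \<Rightarrow> complex \<Rightarrow> complex \<Rightarrow> free set" where
  "daha_ideal q a b c d = Idl\<^bsub>free_alg\<^esub> (daha_rels q a b c d)"

definition daha :: "real \<Rightarrow> complex \<Rightarrow> complex \<Rightarrow> complex \<Rightarrow> complex \<Rightarrow> free set ring" where
  "daha q a b c d = free_alg Quot (daha_ideal q a b c d)"

definition daha_cls :: "real \<Rightarrow> complex \<Rightarrow> complex \<Rightarrow> complex \<Rightarrow> complex \<Rightarrow> free \<Rightarrow> free set" where
  "daha_cls q a b c d u = daha_ideal q a b c d +>\<^bsub>free_alg\<^esub> u"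

definition daha_Y :: "real \<Rightarrow> complex \<Rightarrow> complex \<Rightarrow> complex \<Rightarrow> complex \<Rightarrow> free set" where
  "daha_Y q a b c d =
     daha_cls q a b c d (gn gT1) \<otimes>\<^bsub>daha q a b c d\<^esub> daha_cls q a b c d (gn gT0)"

definition daha_D :: "real \<Rightarrow> complex \<Rightarrow> complex \<Rightarrow> complex \<Rightarrow> complex \<Rightarrow> free set" where
  "daha_D q a b c d =
     daha_Y q a b c d \<oplus>\<^bsub>daha q a b c d\<^esub>
       daha_cls q a b c d (scal (inverse q * a * b * c * d)) \<otimes>\<^bsub>daha q a b c d\<^esub>
         (inv\<^bsub>daha q a b c d\<^esub> (daha_Y q a b c d))"


section \<open>The isomorphism \<open>t\<^sub>4\<close>\<close>

definition t4_gen :: "real \<Rightarrow> complex \<Rightarrow> complex \<Rightarrow> gen \<Rightarrow> free" where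
  "t4_gen q c d g = (if g = gT0 then scal (inverse q * c * d) * gn gT0 else gn g)"

definition t4_free :: "real \<Rightarrow> complex \<Rightarrow> complex \<Rightarrow> free \<Rightarrow> free" where
  "t4_free q c d u =
     (\<Sum>w\<in>Poly_Mapping.keys u. scal (Poly_Mapping.lookup u w) * prod_list (map (t4_gen q c d) (letters w)))"

text \<open>
  The map on residue classes induced by the substitution homomorphism \<^const>\<open>t4_free\<close>; the image
  below is a singleton because that homomorphism respects the relations, see \<open>t4_cls\<close>.
\<close>

definition t4 :: "real \<Rightarrow> complex \<Rightarrow> complex \<Rightarrow> complex \<Rightarrow> complex \<Rightarrow> free set \<Rightarrow> free set" where
  "t4 q a b c d U = the_elem ((\<lambda>u. daha_cls q a b (q / d) (q / c) (t4_free q c d u)) ` U)"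


section \<open>Meromorphic functions on the punctured plane\<close>

text \<open>
  Functions meromorphic on \<open>\<complex> - {0}\<close> are identified when they agree off a discrete closed subset
  of it, so that values at poles and at removable singularities do not matter.
\<close>

quotient_type mero = "complex \<Rightarrow> complex" / partial:
  "\<lambda>f g. f meromorphic_on (-{0}) \<and> g meromorphic_on (-{0}) \<and> (\<forall>\<^sub>\<approx>z\<in>-{0}. f z = g z)"
proof (rule part_equivpI)
  show "\<exists>f. f meromorphic_on (-{0}) \<and> f meromorphic_on (-{0}) \<and> (\<forall>\<^sub>\<approx>z\<in>-{0}. f z = f z)"
    by (intro exI[of _ "\<lambda>_. 0"]) auto
  show "symp (\<lambda>f g. f meromorphic_on (-{0}) \<and> g meromorphic_on (-{0}) \<and> (\<forall>\<^sub>\<approx>z\<in>-{0}. f z = g z))"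
    by (auto intro!: sympI elim: eventually_mono)
  show "transp (\<lambda>f g. f meromorphic_on (-{0}) \<and> g meromorphic_on (-{0}) \<and> (\<forall>\<^sub>\<approx>z\<in>-{0}. f z = g z))"
    by (auto intro!: transpI elim: eventually_elim2)
qed

instantiation mero :: comm_ring_1
begin

lift_definition zero_mero :: mero is "\<lambda>_. 0" by auto
lift_definition one_mero :: mero is "\<lambda>_. 1" by auto
lift_definition plus_mero :: "mero \<Rightarrow> mero \<Rightarrow> mero" is "\<lambda>f g z. f z + g z"
  by (auto intro!: meromorphic_intros elim: eventually_elim2)
lift_definition minus_mero :: "mero \<Rightarrow> mero \<Rightarrow> mero" is "\<lambda>f g z. f z - g z"
  by (auto intro!: meromorphic_intros elim: eventually_elim2)
lift_definition uminus_mero :: "mero \<Rightarrow> mero" is "\<lambda>f z. - f z"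
  by (auto intro!: meromorphic_intros elim: eventually_mono)
lift_definition times_mero :: "mero \<Rightarrow> mero \<Rightarrow> mero" is "\<lambda>f g z. f z * g z"
  by (auto intro!: meromorphic_intros elim: eventually_elim2)

instance
proof
  show "(0::mero) \<noteq> 1"
    by transfer (auto simp: eventually_False)
qed (transfer; auto intro!: meromorphic_intros simp: algebra_simps)+

end

lift_definition smul :: "complex \<Rightarrow> mero \<Rightarrow> mero" is "\<lambda>k f z. k * f z"
  by (auto intro!: meromorphic_intros elim: eventually_mono)

definition opsmul :: "complex \<Rightarrow> (mero \<Rightarrow> mero) \<Rightarrow> mero \<Rightarrow> mero" where
  "opsmul k A F = smul k (A F)"

text \<open>Multiplication by \<open>h\<close>; meaningful only for \<open>h\<close> meromorphic on the punctured plane.\<close>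

definition mop :: "(complex \<Rightarrow> complex) \<Rightarrow> mero \<Rightarrow> mero" where
  "mop h F = abs_mero h * F"

lemma cosparse_compose:
  fixes s :: complex
  assumes "\<forall>\<^sub>\<approx>z\<in>-{0}. P z" and "s \<noteq> 0"
  shows "\<forall>\<^sub>\<approx>z\<in>-{0}. P (s / z)"
proof -
  have "eventually (\<lambda>z. P (s / z)) (at z)" if z: "z \<noteq> 0" for z
  proof -
    have "\<forall>\<^sub>F w in at z. w \<in> - {0} - {z}"
      using z by (intro eventually_at_in_open) auto
    then have "\<forall>\<^sub>F w in at z. s / w \<noteq> s / z"
      by (rule eventually_mono) (use z \<open>s \<noteq> 0\<close> in \<open>auto simp: field_simps\<close>)
    moreover have "((\<lambda>z. s / z) \<longlongrightarrow> s / z) (at z)"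
      using z by (intro tendsto_intros)
    ultimately have "filterlim (\<lambda>z. s / z) (at (s / z)) (at z)"
      by (simp add: filterlim_at)
    moreover have "eventually P (at (s / z))"
      using assms z by (intro eventually_cosparse_imp_eventually_at[of _ "-{0}"]) auto
    ultimately show ?thesis
      by (metis eventually_compose_filterlim)
  qed
  then show ?thesis
    by (subst eventually_cosparse_open_eq) auto
qed

lemma meromorphic_refl:
  assumes "f meromorphic_on (-{0})" and "s \<noteq> 0"
  shows "(\<lambda>z. f (s / z)) meromorphic_on (-{0})"
proof (rule meromorphic_on_compose[OF assms(1)])
  show "(\<lambda>z. s / z) analytic_on (-{0})"
    by (intro analytic_on_divide analytic_on_const analytic_on_ident) auto
qed (use assms in auto)


section \<open>The basic representation\<close>

lift_definition T1_op :: "complex \<Rightarrow> complex \<Rightarrow> mero \<Rightarrow> mero" is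
  "\<lambda>a b f z. - a * b * f z
     + inverse z * (1 - a * z) * (1 - b * z) * ((f z - f (inverse z)) / (z - inverse z))"
  subgoal premises fg for a b f g
  proof -
    have "(\<lambda>z. f (inverse z)) meromorphic_on (-{0})" "(\<lambda>z. g (inverse z)) meromorphic_on (-{0})"
      using fg meromorphic_refl[of _ 1] by (auto simp: inverse_eq_divide)
    moreover have "\<forall>\<^sub>\<approx>z\<in>-{0}. f z = g z \<and> f (inverse z) = g (inverse z)"
      using fg cosparse_compose[of "\<lambda>z. f z = g z" 1]
      by (auto simp: inverse_eq_divide intro: eventually_conj)
    ultimately show ?thesis
      using fg by (intro conjI meromorphic_intros) (auto elim: eventually_mono)
  qed
  done

text \<open>The value for \<open>q = 0\<close> is arbitrary; \<open>f (0 / z)\<close> would not respect the identification.\<close>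

lift_definition T0_op :: "real \<Rightarrow> complex \<Rightarrow> complex \<Rightarrow> mero \<Rightarrow> mero" is
  "\<lambda>(q::real) c d f (z::complex). if q = 0 then 0 else - inverse q * c * d * f z
     - inverse z * (c - z) * (d - z) * ((f z - f (q * inverse z)) / (z - q * inverse z))"
  subgoal premises fg for q c d f g
  proof (cases "q = 0")
    case False
    have "(\<lambda>z. f (q * inverse z)) meromorphic_on (-{0})" "(\<lambda>z. g (q * inverse z)) meromorphic_on (-{0})"
      using fg False meromorphic_refl[of _ q] by (auto simp: divide_inverse)
    moreover have "\<forall>\<^sub>\<approx>z\<in>-{0::complex}. f z = g z \<and> f (q * inverse z) = g (q * inverse z)"
      using fg False cosparse_compose[of "\<lambda>z. f z = g z" q]
      by (auto simp: divide_inverse intro: eventually_conj)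
    ultimately show ?thesis
      using fg
      by (simp only: of_real_eq_0_iff False if_False) (intro conjI meromorphic_intros; auto elim: eventually_mono)
  qed auto
  done

fun gen_op :: "real \<Rightarrow> complex \<Rightarrow> complex \<Rightarrow> complex \<Rightarrow> complex \<Rightarrow> gen \<Rightarrow> mero \<Rightarrow> mero" where
  "gen_op q a b c d gT1 = T1_op a b"
| "gen_op q a b c d gT0 = T0_op q c d"
| "gen_op q a b c d gZ = mop (\<lambda>z. z)"
| "gen_op q a b c d gZi = mop inverse"

definition free_rep ::
  "real \<Rightarrow> complex \<Rightarrow> complex \<Rightarrow> complex \<Rightarrow> complex \<Rightarrow> free \<Rightarrow> mero \<Rightarrow> mero" where
  "free_rep q a b c d u F =
     (\<Sum>w\<in>Poly_Mapping.keys u. smul (Poly_Mapping.lookup u w) (foldr (gen_op q a b c d) (letters w) F))"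

text \<open>The common action of the representatives of a residue class, see \<open>basic_rep_cls\<close>.\<close>

definition basic_rep ::
  "real \<Rightarrow> complex \<Rightarrow> complex \<Rightarrow> complex \<Rightarrow> complex \<Rightarrow> free set \<Rightarrow> mero \<Rightarrow> mero" where
  "basic_rep q a b c d U = the_elem (free_rep q a b c d ` U)"

section \<open>Gaussians and genericity\<close>

definition gauss :: "real \<Rightarrow> complex \<Rightarrow> complex \<Rightarrow> complex" where
  "gauss q e z = 1 / prodinf (\<lambda>j. (1 - e * z * q ^ j) * (1 - e * inverse z * q ^ j))"

definition generic :: "complex \<Rightarrow> complex \<Rightarrow> complex \<Rightarrow> complex \<Rightarrow> bool" where
  "generic a b c d \<longleftrightarrow> distinct [a, b, c, d, inverse a, inverse b, inverse c, inverse d]"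


section \<open>The map \<open>t\<^sub>4\<close> is well defined on residue classes\<close>

lemma free_expand:
  fixes u :: free
  shows "u = (\<Sum>w\<in>Poly_Mapping.keys u. Poly_Mapping.single w (Poly_Mapping.lookup u w))"
  by (intro poly_mapping_eqI)
    (auto simp: lookup_sum lookup_single when_def sum.delta in_keys_iff)

lemma free_induct [case_names zero single add]:
  fixes u :: free
  assumes "P 0" "\<And>w k. P (Poly_Mapping.single w k)" "\<And>u v. P u \<Longrightarrow> P v \<Longrightarrow> P (u + v)"
  shows "P u"
proof -
  have "P (\<Sum>w\<in>S. Poly_Mapping.single w (Poly_Mapping.lookup u w))" if "finite S" for S
    using that by induction (auto simp: assms)
  from this[OF finite_keys[of u]] show ?thesis
    by (simp flip: free_expand)
qed

lemma sum_keys_single: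
  fixes h :: "word \<Rightarrow> complex \<Rightarrow> 'b :: comm_monoid_add"
  assumes "\<And>w. h w 0 = 0"
  shows "(\<Sum>w\<in>Poly_Mapping.keys (Poly_Mapping.single v k).
            h w (Poly_Mapping.lookup (Poly_Mapping.single v k) w)) = h v k"
  using assms by (cases "k = 0") auto

lemma sum_keys_add:
  fixes h :: "word \<Rightarrow> complex \<Rightarrow> 'b :: comm_monoid_add" and u v :: free
  assumes "\<And>w. h w 0 = 0" "\<And>w k l. h w (k + l) = h w k + h w l"
  shows "(\<Sum>w\<in>Poly_Mapping.keys (u + v). h w (Poly_Mapping.lookup (u + v) w)) =
    (\<Sum>w\<in>Poly_Mapping.keys u. h w (Poly_Mapping.lookup u w)) +
    (\<Sum>w\<in>Poly_Mapping.keys v. h w (Poly_Mapping.lookup v w))"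
proof -
  let ?S = "Poly_Mapping.keys u \<union> Poly_Mapping.keys v"
  have "(\<Sum>w\<in>Poly_Mapping.keys x. h w (Poly_Mapping.lookup x w)) =
        (\<Sum>w\<in>?S. h w (Poly_Mapping.lookup x w))" if "Poly_Mapping.keys x \<subseteq> ?S" for x
    by (intro sum.mono_neutral_left that) (auto simp: in_keys_iff assms)
  from this[of u] this[of v] this[of "u + v"] show ?thesis
    using Poly_Mapping.keys_add[of u v]
    by (simp add: lookup_add assms sum.distrib)
qed

lemma scal_simps:
  "scal 0 = 0" "scal 1 = 1" "scal (k + l) = scal k + scal l" "scal (k * l) = scal k * scal l"
  by (simp_all add: scal_def single_add mult_single)

lemma scal_mult_single: "scal k * Poly_Mapping.single w l = Poly_Mapping.single w (k * l)"
  by (simp add: scal_def mult_single)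

lemma scal_comm: "u * scal k = scal k * u"
  by (induction u rule: free_induct) (simp_all add: scal_def mult_single mult.commute algebra_simps)

lemma t4_free_single:
  "t4_free q c d (Poly_Mapping.single w k) = scal k * prod_list (map (t4_gen q c d) (letters w))"
  unfolding t4_free_def by (rule sum_keys_single) (simp add: scal_simps)

lemma t4_free_add: "t4_free q c d (u + v) = t4_free q c d u + t4_free q c d v"
  unfolding t4_free_def by (rule sum_keys_add) (simp_all add: scal_simps algebra_simps)

lemma t4_free_simps:
  "t4_free q c d (scal k) = scal k" "t4_free q c d 0 = 0" "t4_free q c d 1 = 1"
  "t4_free q c d (gn g) = t4_gen q c d g"
proof -
  show *: "t4_free q c d (scal k) = scal k" for k
    using t4_free_single[of q c d 0 k] by (simp add: scal_def zero_word_def)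
  show "t4_free q c d 0 = 0" "t4_free q c d 1 = 1"
    using *[of 0] *[of 1] by (simp_all add: scal_simps)
  show "t4_free q c d (gn g) = t4_gen q c d g"
    by (simp add: t4_free_single scal_simps gn_def)
qed

lemma t4_free_minus: "t4_free q c d (u - v) = t4_free q c d u - t4_free q c d v"
  using t4_free_add[of q c d "u - v" v] by simp

lemma t4_free_mult: "t4_free q c d (u * v) = t4_free q c d u * t4_free q c d v"
proof (induction u rule: free_induct)
  case (single w k)
  show ?case
  proof (induction v rule: free_induct)
    case (single x l)
    have "t4_free q c d (Poly_Mapping.single w k * Poly_Mapping.single x l) =
      scal k * (scal l * prod_list (map (t4_gen q c d) (letters w))) *
        prod_list (map (t4_gen q c d) (letters x))"
      by (simp add: mult_single t4_free_single plus_word_def scal_simps mult.assoc)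
    then show ?case
      by (simp add: t4_free_single mult.assoc flip: scal_comm[of _ l])
  qed (simp_all add: t4_free_simps t4_free_add algebra_simps)
qed (simp_all add: t4_free_simps t4_free_add algebra_simps)

lemma free_alg_ring: "Ring.ring free_alg"
  by (rule ringI)
    (auto simp: free_alg_def algebra_simps intro!: abelian_groupI monoidI exI[of _ "- _"]
       intro: add.left_inverse)

lemma free_alg_simps [simp]:
  "carrier free_alg = UNIV" "u \<otimes>\<^bsub>free_alg\<^esub> v = u * v" "u \<oplus>\<^bsub>free_alg\<^esub> v = u + v"
  "\<one>\<^bsub>free_alg\<^esub> = 1" "\<zero>\<^bsub>free_alg\<^esub> = 0"
  by (simp_all add: free_alg_def)

lemma free_alg_a_inv [simp]: "\<ominus>\<^bsub>free_alg\<^esub> u = - u"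
  by (rule abelian_group.minus_equality) (simp_all add: free_alg_ring Ring.ring.is_abelian_group)

lemma daha_ideal_ideal: "ideal (daha_ideal q a b c d) free_alg"
  unfolding daha_ideal_def by (rule ring.genideal_ideal) (simp_all add: free_alg_ring)

lemma ideal_freeI:
  assumes "0 \<in> I" "\<And>u v. u \<in> I \<Longrightarrow> v \<in> I \<Longrightarrow> u + v \<in> I" "\<And>u x. u \<in> I \<Longrightarrow> x * u \<in> I"
    "\<And>u x. u \<in> I \<Longrightarrow> u * x \<in> I"
  shows "ideal I free_alg"
proof (rule idealI)
  interpret Ring.ring free_alg by (rule free_alg_ring)
  have neg: "- u \<in> I" if "u \<in> I" for u using assms(3)[OF that, of "-1"] by simp
  show "subgroup I (add_monoid free_alg)"
  proof
    show "inv\<^bsub>add_monoid free_alg\<^esub> x \<in> I" if "x \<in> I" for x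
      using neg[OF that] unfolding a_inv_def[symmetric] by simp
  qed (use assms in auto)
qed (use assms free_alg_ring in auto)

lemma daha_ideal_subset:
  assumes "daha_rels q a b c d \<subseteq> I" "0 \<in> I" "\<And>u v. u \<in> I \<Longrightarrow> v \<in> I \<Longrightarrow> u + v \<in> I"
    "\<And>u x. u \<in> I \<Longrightarrow> x * u \<in> I" "\<And>u x. u \<in> I \<Longrightarrow> u * x \<in> I"
  shows "daha_ideal q a b c d \<subseteq> I"
  unfolding daha_ideal_def using assms
  by (intro ring.genideal_minimal ideal_freeI free_alg_ring)

lemma daha_idealD:
  shows "0 \<in> daha_ideal q a b c d"
    "u \<in> daha_ideal q a b c d \<Longrightarrow> v \<in> daha_ideal q a b c d \<Longrightarrow> u + v \<in> daha_ideal q a b c d"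
    "u \<in> daha_ideal q a b c d \<Longrightarrow> - u \<in> daha_ideal q a b c d"
    "u \<in> daha_ideal q a b c d \<Longrightarrow> x * u \<in> daha_ideal q a b c d"
    "u \<in> daha_ideal q a b c d \<Longrightarrow> u * x \<in> daha_ideal q a b c d"
    "daha_rels q a b c d \<subseteq> daha_ideal q a b c d"
proof -
  interpret ideal "daha_ideal q a b c d" free_alg by (rule daha_ideal_ideal)
  show "0 \<in> daha_ideal q a b c d" using additive_subgroup.zero_closed[OF additive_subgroup_axioms] by simp
  show "u + v \<in> daha_ideal q a b c d"
    if "u \<in> daha_ideal q a b c d" "v \<in> daha_ideal q a b c d" using additive_subgroup.a_closed[OF additive_subgroup_axioms that] by simp
  show "- u \<in> daha_ideal q a b c d" if "u \<in> daha_ideal q a b c d" using additive_subgroup.a_inv_closed[OF additive_subgroup_axioms that] by simp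
  show "x * u \<in> daha_ideal q a b c d" if "u \<in> daha_ideal q a b c d" using I_l_closed that by simp
  show "u * x \<in> daha_ideal q a b c d" if "u \<in> daha_ideal q a b c d" using I_r_closed that by simp
  show "daha_rels q a b c d \<subseteq> daha_ideal q a b c d"
    unfolding daha_ideal_def by (rule genideal_self) simp
qed

lemma in_daha_cls: "v \<in> daha_cls q a b c d u \<longleftrightarrow> v - u \<in> daha_ideal q a b c d"
proof -
  have "v \<in> daha_cls q a b c d u \<longleftrightarrow> (\<exists>h\<in>daha_ideal q a b c d. v = h + u)"
    by (simp add: daha_cls_def a_r_coset_def' )
  then show ?thesis by (metis add_diff_cancel_right' diff_add_cancel)
qed

lemma daha_cls_eq: "daha_cls q a b c d u = daha_cls q a b c d v \<longleftrightarrow> u - v \<in> daha_ideal q a b c d"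
proof
  assume "u - v \<in> daha_ideal q a b c d"
  note uv = this daha_idealD(3)[OF this]
  show "daha_cls q a b c d u = daha_cls q a b c d v"
    using daha_idealD(2)[OF _ uv(1)] daha_idealD(2)[OF _ uv(2)]
    by (auto simp: in_daha_cls set_eq_iff) force+
next
  assume "daha_cls q a b c d u = daha_cls q a b c d v"
  then show "u - v \<in> daha_ideal q a b c d"
    using in_daha_cls[of u q a b c d u] in_daha_cls[of u q a b c d v] daha_idealD(1) by simp
qed

lemma t4_free_daha_ideal:
  assumes "u \<in> daha_ideal q a b c d" "q \<noteq> 0" "c \<noteq> 0" "d \<noteq> 0"
  shows "t4_free q c d u \<in> daha_ideal q a b (q / d) (q / c)"
proof -
  define J where "J = daha_ideal q a b (q / d) (q / c)"
  note J = daha_idealD[where q = q and a = a and b = b and c = "q / d" and d = "q / c", folded J_def]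
  define k where "k = inverse q * c * d"
  have k: "k \<noteq> 0" using assms by (auto simp: k_def)
  have gen: "t4_gen q c d gT0 = scal k * gn gT0" "t4_gen q c d gZi = gn gZi"
    by (simp_all add: t4_gen_def k_def)
  have comm: "scal x * u + scal (x * y) = scal x * (u + scal y)" for x y and u :: free
    by (simp add: scal_simps(4) distrib_left)
  have scal_mid: "(scal x * u) * (scal y * v) = scal (x * y) * (u * v)" for x y and u v :: free
  proof -
    have "(scal x * u) * (scal y * v) = scal x * (u * scal y) * v"
      by (simp only: mult.assoc)
    also have "u * scal y = scal y * u"
      by (rule scal_comm)
    finally show ?thesis
      by (simp only: mult.assoc scal_simps(4))
  qed
  have "(gn gT0 + scal (inverse q * (q / d) * (q / c))) * (gn gT0 + 1) \<in> J"
    using J(6) by (auto simp: daha_rels_def)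
  also have "inverse q * (q / d) * (q / c) = inverse k"
    using assms by (simp add: k_def field_simps)
  also have "(gn gT0 + scal (inverse k)) * (gn gT0 + 1) = (gn gT0 + 1) * (gn gT0 + scal (inverse k))"
    by (simp add: algebra_simps scal_comm)
  finally have *: "scal (k * k) * ((gn gT0 + 1) * (gn gT0 + scal (inverse k))) \<in> J"
    by (rule J)
  have 4: "t4_free q c d ((gn gT0 + scal (inverse q * c * d)) * (gn gT0 + 1)) \<in> J"
    using * comm[of k "gn gT0" 1] comm[of k "gn gT0" "inverse k"] k
    unfolding k_def[symmetric]
    by (simp add: t4_free_mult t4_free_add t4_free_simps gen scal_simps(2) scal_mid)
  have kqd: "k * (q / d) = c" "k * (q / c) = d"
    using assms by (simp_all add: k_def field_simps)
  have pull: "scal k * (scal q * gn gT0 * gn gZi + scal (q / e)) =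
      scal q * (scal k * gn gT0) * gn gZi + scal (k * (q / e))" for e :: complex
  proof -
    have "scal k * scal q = scal q * scal k"
      by (rule scal_comm)
    then show ?thesis
      by (metis (no_types, lifting) distrib_left mult.assoc scal_simps(4))
  qed
  have "scal (k * k) * ((scal q * gn gT0 * gn gZi + scal (q / d)) *
         (scal q * gn gT0 * gn gZi + scal (q / c))) \<in> J"
    by (rule J(4)) (use J(6) in \<open>auto simp: daha_rels_def\<close>)
  also have "scal (k * k) * ((scal q * gn gT0 * gn gZi + scal (q / d)) *
         (scal q * gn gT0 * gn gZi + scal (q / c))) =
       (scal k * (scal q * gn gT0 * gn gZi + scal (q / d))) *
       (scal k * (scal q * gn gT0 * gn gZi + scal (q / c)))"
    by (simp only: scal_mid)
  also have "scal k * (scal q * gn gT0 * gn gZi + scal (q / d)) =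
      scal q * (scal k * gn gT0) * gn gZi + scal c"
    using pull[of d] kqd by simp
  also have "scal k * (scal q * gn gT0 * gn gZi + scal (q / c)) =
      scal q * (scal k * gn gT0) * gn gZi + scal d"
    using pull[of c] kqd by simp
  finally have 3: "t4_free q c d ((scal q * gn gT0 * gn gZi + scal c) *
       (scal q * gn gT0 * gn gZi + scal d)) \<in> J"
    by (simp only: t4_free_mult t4_free_add t4_free_simps gen)
  have "daha_ideal q a b c d \<subseteq> {u. t4_free q c d u \<in> J}"
  proof (rule daha_ideal_subset)
    show "daha_rels q a b c d \<subseteq> {u. t4_free q c d u \<in> J}"
      using 3 4 J(6)
      by (auto simp: daha_rels_def t4_free_mult t4_free_minus t4_free_add t4_free_simps t4_gen_def)
  qed (auto simp: t4_free_mult t4_free_add t4_free_simps intro: J)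
  then show ?thesis using assms by (auto simp: J_def)
qed

lemma t4_cls:
  assumes "q \<noteq> 0" "c \<noteq> 0" "d \<noteq> 0"
  shows "t4 q a b c d (daha_cls q a b c d u) = daha_cls q a b (q / d) (q / c) (t4_free q c d u)"
proof -
  have "(\<lambda>u. daha_cls q a b (q / d) (q / c) (t4_free q c d u)) ` daha_cls q a b c d u
    = {daha_cls q a b (q / d) (q / c) (t4_free q c d u)}" (is "?f ` _ = _")
  proof
    show "?f ` daha_cls q a b c d u \<subseteq> {?f u}"
      using t4_free_daha_ideal[OF _ assms]
      by (intro image_subsetI) (simp add: in_daha_cls daha_cls_eq flip: t4_free_minus)
    have "u \<in> daha_cls q a b c d u" by (simp add: in_daha_cls daha_idealD)
    then show "{?f u} \<subseteq> ?f ` daha_cls q a b c d u" by blast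
  qed
  then show ?thesis by (simp add: t4_def)
qed


section \<open>The basic representation is well defined on residue classes\<close>

lemma T1_alg:
  fixes z w D F G a b :: complex
  assumes "z \<noteq> 0" "z * z \<noteq> 1" and w: "w = 1 / z" and D: "D = z / (z * z - 1)"
  defines "t \<equiv> \<lambda>F G. - a * b * F + w * (1 - a * z) * (1 - b * z) * ((F - G) * D)"
  defines "t' \<equiv> \<lambda>F G. - a * b * G + z * (1 - a * w) * (1 - b * w) * ((G - F) * - D)"
  shows "t (t F G + F) (t' F G + G) + a * b * (t F G + F) = 0"
    "t (z * (t (z * F) (w * G) + b * F)) (w * (t' (z * F) (w * G) + b * G))
       + a * (t (z * F) (w * G) + b * F) = 0"
proof -
  have z: "z * z - 1 \<noteq> 0" using assms by auto
  show "t (t F G + F) (t' F G + G) + a * b * (t F G + F) = 0"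
    unfolding t_def t'_def w D using assms(1) z by (simp add: divide_simps) (simp add: algebra_simps)?
  show "t (z * (t (z * F) (w * G) + b * F)) (w * (t' (z * F) (w * G) + b * G))
       + a * (t (z * F) (w * G) + b * F) = 0"
    unfolding t_def t'_def w D using assms(1) z by (simp add: divide_simps) (simp add: algebra_simps)
qed

lemma T0_alg:
  fixes z w D F G c d q p :: complex
  assumes "q \<noteq> 0" "z \<noteq> 0" "z * z \<noteq> q" and p: "p = 1 / q" and w: "w = q / z" and D: "D = z / (z * z - q)"
  defines "t \<equiv> \<lambda>F G. - p * c * d * F - p * w * (c - z) * (d - z) * ((F - G) * D)"
  defines "t' \<equiv> \<lambda>F G. - p * c * d * G - p * z * (c - w) * (d - w) * ((G - F) * - D)"
  shows "t (t F G + F) (t' F G + G) + p * c * d * (t F G + F) = 0"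
    "q * t (p * w * (q * t (p * w * F) (p * z * G) + d * F)) (p * z * (q * t' (p * w * F) (p * z * G) + d * G))
       + c * (q * t (p * w * F) (p * z * G) + d * F) = 0"
proof -
  have z: "z * z - q \<noteq> 0" using assms by auto
  show "t (t F G + F) (t' F G + G) + p * c * d * (t F G + F) = 0"
    unfolding t_def t'_def p w D using assms(1,2) z by (simp add: divide_simps) (simp add: algebra_simps)?
  show "q * t (p * w * (q * t (p * w * F) (p * z * G) + d * F)) (p * z * (q * t' (p * w * F) (p * z * G) + d * G))
       + c * (q * t (p * w * F) (p * z * G) + d * F) = 0"
    unfolding t_def t'_def p w D using assms(1,2) z by (simp add: divide_simps) (simp add: algebra_simps)
qed

lemma smul_simps:
  "smul k (F + G) = smul k F + smul k G" "smul (k + l) F = smul k F + smul l F"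
  "smul k (smul l F) = smul (k * l) F" "smul 1 F = F" "smul 0 F = 0" "smul k 0 = 0"
  by (transfer; auto intro!: meromorphic_intros simp: algebra_simps)+

lemma mop_linear:
  "mop h (F + G) = mop h F + mop h G" "mop h (smul k F) = smul k (mop h F)"
proof -
  show "mop h (F + G) = mop h F + mop h G"
    by (simp add: mop_def algebra_simps)
  have "M * smul k F = smul k (M * F)" for M
    by (transfer; auto intro!: meromorphic_intros simp: algebra_simps)
  then show "mop h (smul k F) = smul k (mop h F)"
    by (simp add: mop_def)
qed

lemma mero_refl_inverse:
  "f meromorphic_on (-{0}) \<Longrightarrow> (\<lambda>z. f (inverse z)) meromorphic_on (-{0})"
  using meromorphic_refl[of f 1] by (simp add: inverse_eq_divide)

lemma mero_refl_q:
  "f meromorphic_on (-{0}) \<Longrightarrow> q \<noteq> 0 \<Longrightarrow> (\<lambda>z. f (q * inverse z)) meromorphic_on (-{0})"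
  using meromorphic_refl[of f q] by (simp add: divide_inverse)

lemma T1_op_linear:
  "T1_op a b (F + G) = T1_op a b F + T1_op a b G"
  "T1_op a b (smul k F) = smul k (T1_op a b F)"
  by (transfer; intro conjI meromorphic_intros mero_refl_inverse;
      simp add: diff_divide_distrib add_divide_distrib algebra_simps)+

lemma T0_op_linear:
  "T0_op q c d (F + G) = T0_op q c d F + T0_op q c d G"
  "T0_op q c d (smul k F) = smul k (T0_op q c d F)"
proof -
  show "T0_op q c d (F + G) = T0_op q c d F + T0_op q c d G"
  proof (cases "q = 0")
    case True
    then show ?thesis by transfer auto
  next
    case False
    then show ?thesis
      by transfer (simp, intro conjI meromorphic_intros mero_refl_q;
        simp add: diff_divide_distrib add_divide_distrib algebra_simps)
  qed
  show "T0_op q c d (smul k F) = smul k (T0_op q c d F)"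
  proof (cases "q = 0")
    case True
    then show ?thesis by transfer auto
  next
    case False
    then show ?thesis
      by transfer (simp, intro conjI meromorphic_intros mero_refl_q;
        simp add: diff_divide_distrib add_divide_distrib algebra_simps)
  qed
qed

lemma gen_op_linear:
  "gen_op q a b c d g (F + G) = gen_op q a b c d g F + gen_op q a b c d g G"
  "gen_op q a b c d g (smul k F) = smul k (gen_op q a b c d g F)"
  by (cases g; simp add: T1_op_linear T0_op_linear mop_linear)+

lemma foldr_linear:
  "foldr (gen_op q a b c d) gs (F + G) = foldr (gen_op q a b c d) gs F + foldr (gen_op q a b c d) gs G"
  "foldr (gen_op q a b c d) gs (smul k F) = smul k (foldr (gen_op q a b c d) gs F)"
  by (induction gs) (simp_all add: gen_op_linear)

lemma free_rep_single:
  "free_rep q a b c d (Poly_Mapping.single w k) F = smul k (foldr (gen_op q a b c d) (letters w) F)"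
  unfolding free_rep_def by (rule sum_keys_single) (simp add: smul_simps)

lemma free_rep_add: "free_rep q a b c d (u + v) F = free_rep q a b c d u F + free_rep q a b c d v F"
  unfolding free_rep_def by (rule sum_keys_add) (simp_all add: smul_simps)

lemma free_rep_simps:
  "free_rep q a b c d (scal k) F = smul k F" "free_rep q a b c d 0 F = 0"
  "free_rep q a b c d 1 F = F" "free_rep q a b c d (gn g) F = gen_op q a b c d g F"
proof -
  show *: "free_rep q a b c d (scal k) F = smul k F" for k
    using free_rep_single[of q a b c d 0 k] by (simp add: scal_def zero_word_def)
  show "free_rep q a b c d 0 F = 0" "free_rep q a b c d 1 F = F"
    using *[of 0] *[of 1] by (simp_all add: scal_simps smul_simps)
  show "free_rep q a b c d (gn g) F = gen_op q a b c d g F"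
    by (simp add: free_rep_single smul_simps gn_def)
qed

lemma free_rep_minus: "free_rep q a b c d (u - v) F = free_rep q a b c d u F - free_rep q a b c d v F"
  using free_rep_add[of q a b c d "u - v" v F] by (simp add: algebra_simps)

lemma free_rep_linear:
  "free_rep q a b c d u (F + G) = free_rep q a b c d u F + free_rep q a b c d u G"
  "free_rep q a b c d u (smul k F) = smul k (free_rep q a b c d u F)"
  by (induction u rule: free_induct)
    (simp_all add: free_rep_single free_rep_add free_rep_simps foldr_linear smul_simps algebra_simps)

lemma free_rep_mult: "free_rep q a b c d (u * v) F = free_rep q a b c d u (free_rep q a b c d v F)"
proof (induction u rule: free_induct)
  case zero
  then show ?case by (simp add: free_rep_simps)
next
  case (single w k)
  show ?case
  proof (induction v rule: free_induct)
    case zero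
    show ?case
      using foldr_linear(2)[of q a b c d "letters w" 0 0]
      by (simp add: free_rep_simps free_rep_single smul_simps)
  next
    case (single x l)
    show ?case
      by (simp add: mult_single free_rep_single plus_word_def foldr_linear smul_simps)
  next
    case (add v v')
    then show ?case
      by (simp add: distrib_left free_rep_add free_rep_linear)
  qed
next
  case (add u u')
  then show ?case by (simp add: distrib_right free_rep_add)
qed

lemma abs_mero_eqI:
  assumes "f meromorphic_on (-{0})" "g meromorphic_on (-{0})" "\<forall>\<^sub>\<approx>z\<in>-{0}. f z = g z"
  shows "abs_mero f = abs_mero g"
  using assms Quotient_rel_abs[OF Quotient_mero] by blast

lemma mero_cases:
  obtains f where "F = abs_mero f" "f meromorphic_on (-{0})"
proof -
  have "F = abs_mero (rep_mero F)" "rep_mero F meromorphic_on (-{0})"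
    using Quotient_abs_rep[OF Quotient_mero, of F] Quotient_rep_reflp[OF Quotient_mero, of F] by auto
  then show ?thesis by (rule that)
qed

lemma mop_abs:
  "h meromorphic_on (-{0}) \<Longrightarrow> f meromorphic_on (-{0}) \<Longrightarrow>
     mop h (abs_mero f) = abs_mero (\<lambda>z. h z * f z)"
  unfolding mop_def by (rule times_mero.abs_eq) auto

lemma eventually_sq_neq: "\<forall>\<^sub>\<approx>z\<in>-{0::complex}. z \<noteq> 0 \<and> z * z \<noteq> k"
proof (subst eventually_cosparse_open_eq)
  have fin: "finite {z::complex. z * z = k}"
    using finite_nth_roots[of 2 k] by (simp add: power2_eq_square)
  show "\<forall>x\<in>-{0::complex}. \<forall>\<^sub>F z in at x. z \<noteq> 0 \<and> z * z \<noteq> k"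
  proof
    fix x :: complex assume "x \<in> -{0}"
    have "finite (insert 0 {z::complex. z * z = k} - {x})"
      using fin by simp
    then have "\<forall>\<^sub>F z in at x. z \<in> - (insert 0 {z::complex. z * z = k} - {x}) - {x}"
      by (intro eventually_at_in_open open_Compl finite_imp_closed) auto
    then show "\<forall>\<^sub>F z in at x. z \<noteq> 0 \<and> z * z \<noteq> k"
      by (rule eventually_mono) auto
  qed
qed auto

lemma mop_z: "mop (\<lambda>z. z) = (*) (abs_mero (\<lambda>z. z))" and mop_inv: "mop inverse = (*) (abs_mero inverse)"
  by (auto simp: mop_def)

lemma T1_point:
  fixes f :: "complex \<Rightarrow> complex" and a b :: complex
  defines "t \<equiv> \<lambda>f z. - a * b * f z
     + inverse z * (1 - a * z) * (1 - b * z) * ((f z - f (inverse z)) / (z - inverse z))"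
  assumes "z \<noteq> 0" "z * z \<noteq> 1"
  shows "t (\<lambda>z. t f z + f z) z + a * b * (t f z + f z) = 0"
    "t (\<lambda>z. z * (t (\<lambda>z. z * f z) z + b * f z)) z
       + a * (t (\<lambda>z. z * f z) z + b * f z) = 0"
proof -
  define w D where "w = inverse z" and "D = inverse (z - w)"
  have w: "inverse w = z" "w = 1 / z" and D: "D = z / (z * z - 1)"
    using assms by (auto simp: w_def D_def field_simps)
  have D': "inverse (w - z) = - D"
    unfolding D_def by (subst inverse_minus_eq[symmetric]) simp
  show "t (\<lambda>z. t f z + f z) z + a * b * (t f z + f z) = 0"
    using T1_alg(1)[OF assms(2,3) w(2) D, of a b "f z" "f w"]
    unfolding t_def divide_inverse w_def[symmetric] w(1) D_def[symmetric] D' .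
  show "t (\<lambda>z. z * (t (\<lambda>z. z * f z) z + b * f z)) z
       + a * (t (\<lambda>z. z * f z) z + b * f z) = 0"
    using T1_alg(2)[OF assms(2,3) w(2) D, of a b "f z" "f w"]
    unfolding t_def divide_inverse w_def[symmetric] w(1) D_def[symmetric] D' .
qed

lemma T0_point:
  fixes f :: "complex \<Rightarrow> complex" and q c d :: complex
  defines "t \<equiv> \<lambda>f z. - inverse q * c * d * f z
     - inverse z * (c - z) * (d - z) * ((f z - f (q * inverse z)) / (z - q * inverse z))"
  assumes "q \<noteq> 0" "z \<noteq> 0" "z * z \<noteq> q"
  shows "t (\<lambda>z. t f z + f z) z + inverse q * c * d * (t f z + f z) = 0"
    "q * t (\<lambda>z. inverse z * (q * t (\<lambda>z. inverse z * f z) z + d * f z)) z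
       + c * (q * t (\<lambda>z. inverse z * f z) z + d * f z) = 0"
proof -
  define w D p where "w = q * inverse z" and "D = inverse (z - w)" and "p = inverse q"
  have w: "inverse z = p * w" "inverse w = p * z" "q * (p * w) = w" "q * (p * z) = z"
    "w = q / z" and D: "D = z / (z * z - q)" and p: "p = 1 / q"
    using assms by (auto simp: w_def D_def p_def field_simps)
  have D': "inverse (w - z) = - D"
    unfolding D_def by (subst inverse_minus_eq[symmetric]) simp
  show "t (\<lambda>z. t f z + f z) z + inverse q * c * d * (t f z + f z) = 0"
    using T0_alg(1)[OF assms(2-4) p w(5) D, of c d "f z" "f w"]
    unfolding t_def divide_inverse w(1-4) D_def[symmetric] D' p_def[symmetric] .
  show "q * t (\<lambda>z. inverse z * (q * t (\<lambda>z. inverse z * f z) z + d * f z)) z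
       + c * (q * t (\<lambda>z. inverse z * f z) z + d * f z) = 0"
    using T0_alg(2)[OF assms(2-4) p w(5) D, of c d "f z" "f w"]
    unfolding t_def divide_inverse w(1-4) D_def[symmetric] D' p_def[symmetric] .
qed

lemma mero_id [simp]: "(\<lambda>z. z) meromorphic_on A" and mero_inverse [simp]: "inverse meromorphic_on A"
  using meromorphic_on_inverse[OF meromorphic_on_id[of A]] by (auto simp: meromorphic_on_id)

lemma T1_raw_mero:
  "f meromorphic_on (-{0}) \<Longrightarrow> (\<lambda>z. - a * b * f z
     + inverse z * (1 - a * z) * (1 - b * z) * ((f z - f (inverse z)) / (z - inverse z))) meromorphic_on (-{0})"
  by (intro meromorphic_intros mero_refl_inverse)

lemma T0_raw_mero:
  "f meromorphic_on (-{0}) \<Longrightarrow> q \<noteq> 0 \<Longrightarrow> (\<lambda>z. - inverse q * c * d * f z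
     - inverse z * (c - z) * (d - z) * ((f z - f (q * inverse z)) / (z - q * inverse z))) meromorphic_on (-{0})"
  by (intro meromorphic_intros mero_refl_q)

lemma T1_op_abs:
  "f meromorphic_on (-{0}) \<Longrightarrow> T1_op a b (abs_mero f) = abs_mero (\<lambda>z. - a * b * f z
     + inverse z * (1 - a * z) * (1 - b * z) * ((f z - f (inverse z)) / (z - inverse z)))"
  by (rule T1_op.abs_eq) auto

lemma T0_op_abs:
  assumes "f meromorphic_on (-{0})" "q \<noteq> 0"
  shows "T0_op q c d (abs_mero f) = abs_mero (\<lambda>z. - inverse q * c * d * f z
     - inverse z * (c - z) * (d - z) * ((f z - f (q * inverse z)) / (z - q * inverse z)))"
  using T0_op.abs_eq[of f q c d] assms by simp

lemma plus_abs:
  "f meromorphic_on (-{0}) \<Longrightarrow> g meromorphic_on (-{0}) \<Longrightarrow>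
     abs_mero f + abs_mero g = abs_mero (\<lambda>z. f z + g z)"
  by (rule plus_mero.abs_eq) auto

lemma smul_abs: "f meromorphic_on (-{0}) \<Longrightarrow> smul k (abs_mero f) = abs_mero (\<lambda>z. k * f z)"
  by (rule smul.abs_eq) auto

lemma abs_mero_eq_0I:
  assumes "f meromorphic_on (-{0})" "\<And>z. z \<noteq> 0 \<Longrightarrow> z * z \<noteq> k \<Longrightarrow> f z = 0"
  shows "abs_mero f = 0"
  unfolding zero_mero_def
  by (rule abs_mero_eqI) (use assms eventually_mono[OF eventually_sq_neq[of k]] in auto)

lemma rel_T1:
  "T1_op a b (T1_op a b F + F) + smul (a * b) (T1_op a b F + F) = 0"
  "T1_op a b (mop (\<lambda>z. z) (T1_op a b (mop (\<lambda>z. z) F) + smul b F))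
      + smul a (T1_op a b (mop (\<lambda>z. z) F) + smul b F) = 0"
proof -
  obtain f where F: "F = abs_mero f" and f: "f meromorphic_on (-{0})"
    by (rule mero_cases)
  note m = f T1_raw_mero meromorphic_on_add meromorphic_on_mult meromorphic_on_const mero_id
  note r = T1_op_abs plus_abs smul_abs mop_abs
  show "T1_op a b (T1_op a b F + F) + smul (a * b) (T1_op a b F + F) = 0"
    unfolding F
    apply (subst r, (intro m)+)+
    apply (rule abs_mero_eq_0I[of _ 1], intro m)
    apply (rule T1_point(1); assumption)
    done
  show "T1_op a b (mop (\<lambda>z. z) (T1_op a b (mop (\<lambda>z. z) F) + smul b F))
      + smul a (T1_op a b (mop (\<lambda>z. z) F) + smul b F) = 0"
    unfolding F
    apply (subst r, (intro m)+)+
    apply (rule abs_mero_eq_0I[of _ 1], intro m)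
    apply (rule T1_point(2); assumption)
    done
qed

lemma rel_T0:
  fixes q :: real and c d :: complex
  assumes "q \<noteq> 0"
  shows "T0_op q c d (T0_op q c d F + F) + smul (inverse q * c * d) (T0_op q c d F + F) = 0"
    "smul q (T0_op q c d (mop inverse (smul q (T0_op q c d (mop inverse F)) + smul d F)))
      + smul c (smul q (T0_op q c d (mop inverse F)) + smul d F) = 0"
proof -
  have q: "complex_of_real q \<noteq> 0" using assms by simp
  obtain f where F: "F = abs_mero f" and f: "f meromorphic_on (-{0})"
    by (rule mero_cases)
  note m = f T0_raw_mero meromorphic_on_add meromorphic_on_mult meromorphic_on_const
    mero_inverse q
  note r = T0_op_abs[OF _ assms] plus_abs smul_abs mop_abs
  show "T0_op q c d (T0_op q c d F + F) + smul (inverse q * c * d) (T0_op q c d F + F) = 0"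
    unfolding F
    apply (subst r, (intro m)+)+
    apply (rule abs_mero_eq_0I[of _ q], intro m)
    apply (subst of_real_inverse)
    apply (rule T0_point(1)[OF q]; assumption)
    done
  show "smul q (T0_op q c d (mop inverse (smul q (T0_op q c d (mop inverse F)) + smul d F)))
      + smul c (smul q (T0_op q c d (mop inverse F)) + smul d F) = 0"
    unfolding F
    apply (subst r, (intro m)+)+
    apply (rule abs_mero_eq_0I[of _ q], intro m)
    apply (rule T0_point(2)[OF q]; assumption)
    done
qed

lemma rel_Z: "mop (\<lambda>z. z) (mop inverse F) = F" "mop inverse (mop (\<lambda>z. z) F) = F"
proof -
  obtain f where F: "F = abs_mero f" and f: "f meromorphic_on (-{0})"
    by (rule mero_cases)
  note m = f meromorphic_on_mult mero_id mero_inverse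
  have nz: "\<forall>\<^sub>\<approx>z\<in>-{0::complex}. z \<noteq> 0"
    using eventually_sq_neq[of 0] by (rule eventually_mono) auto
  show "mop (\<lambda>z. z) (mop inverse F) = F"
    unfolding F
    apply (subst mop_abs, (intro m)+)+
    apply (rule abs_mero_eqI, (intro m)+)
    apply (rule eventually_mono[OF nz], simp)
    done
  show "mop inverse (mop (\<lambda>z. z) F) = F"
    unfolding F
    apply (subst mop_abs, (intro m)+)+
    apply (rule abs_mero_eqI, (intro m)+)
    apply (rule eventually_mono[OF nz], simp)
    done
qed

lemma free_rep_daha_ideal:
  assumes "u \<in> daha_ideal q a b c d" "q \<noteq> 0"
  shows "free_rep q a b c d u F = 0"
proof -
  have lin0: "free_rep q a b c d x 0 = 0" for x
    using free_rep_linear(2)[of q a b c d x 0 0] by (simp add: smul_simps)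
  have "daha_ideal q a b c d \<subseteq> {u. \<forall>F. free_rep q a b c d u F = 0}"
  proof (rule daha_ideal_subset)
    show "daha_rels q a b c d \<subseteq> {u. \<forall>F. free_rep q a b c d u F = 0}"
      using rel_T1[of a b] rel_T0[OF assms(2), of c d]
      by (auto simp: daha_rels_def free_rep_mult free_rep_add free_rep_minus free_rep_simps rel_Z)
  qed (auto simp: free_rep_mult free_rep_add free_rep_simps lin0)
  then show ?thesis using assms by auto
qed

lemma basic_rep_cls:
  assumes "q \<noteq> 0"
  shows "basic_rep q a b c d (daha_cls q a b c d u) = free_rep q a b c d u"
proof -
  have "free_rep q a b c d ` daha_cls q a b c d u = {free_rep q a b c d u}"
  proof
    show "free_rep q a b c d ` daha_cls q a b c d u \<subseteq> {free_rep q a b c d u}"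
      using free_rep_daha_ideal[OF _ assms]
      by (intro image_subsetI) (metis in_daha_cls ext free_rep_minus right_minus_eq singletonI)
    have "u \<in> daha_cls q a b c d u" by (simp add: in_daha_cls daha_idealD)
    then show "{free_rep q a b c d u} \<subseteq> free_rep q a b c d ` daha_cls q a b c d u" by blast
  qed
  then show ?thesis by (simp add: basic_rep_def)
qed


section \<open>The Gaussians are meromorphic\<close>

lemma gauss_denominator:
  fixes q :: real and e :: complex
  assumes q: "0 < q" "q < 1"
  defines "f \<equiv> \<lambda>j z. (1 - e * z * q ^ j) * (1 - e * inverse z * q ^ j)"
  shows "\<And>z. z \<noteq> 0 \<Longrightarrow> abs_convergent_prod (\<lambda>j. f j z)"
    and "(\<lambda>z. prodinf (\<lambda>j. f j z)) holomorphic_on -{0}"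
proof -
  define B where "B z = norm e * norm z + norm e * norm (inverse z) + norm e * norm z * (norm e * norm (inverse z))"
    for z :: complex
  have le: "norm (f j z - 1) \<le> B z * q ^ j" for j z
  proof -
    define x y where "x = e * z * q ^ j" and "y = e * inverse z * q ^ j"
    have "f j z - 1 = - x - y + x * y"
      by (simp add: f_def x_def y_def algebra_simps)
    also have "norm \<dots> \<le> norm x + norm y + norm x * norm y"
      by (metis norm_minus_cancel norm_mult norm_triangle_le norm_triangle_ineq4 add_mono order_refl)
    also have "norm x = norm e * norm z * q ^ j"
      using q by (simp add: x_def norm_mult norm_power)
    also have "norm y = norm e * norm (inverse z) * q ^ j"
      using q by (simp add: y_def norm_mult norm_power norm_inverse)
    also have "norm e * norm z * q ^ j + norm e * norm (inverse z) * q ^ j +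
        norm e * norm z * q ^ j * (norm e * norm (inverse z) * q ^ j)
      \<le> norm e * norm z * q ^ j + norm e * norm (inverse z) * q ^ j +
        norm e * norm z * q ^ j * (norm e * norm (inverse z) * 1)"
      using q by (intro add_left_mono mult_left_mono power_le_one) auto
    finally show ?thesis
      by (simp add: B_def algebra_simps)
  qed
  have geo: "summable (\<lambda>j. C * q ^ j)" for C :: real
    using q by (intro summable_mult summable_geometric) auto
  show conv: "abs_convergent_prod (\<lambda>j. f j z)" for z
    unfolding abs_convergent_prod_conv_summable
    by (rule summable_comparison_test'[OF geo[of "B z"], of 0]) (use le in auto)
  show "(\<lambda>z. prodinf (\<lambda>j. f j z)) holomorphic_on -{0}"
  proof (rule holomorphic_uniform_sequence[of _ "\<lambda>n z. \<Prod>j<n. f j z"])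
    show "(\<lambda>z. \<Prod>j<n. f j z) holomorphic_on -{0}" for n
      unfolding f_def by (intro holomorphic_intros) auto
    fix x :: complex assume "x \<in> -{0}"
    then obtain r where r: "r > 0" "cball x r \<subseteq> -{0}"
      using open_contains_cball[of "-{0::complex}"] by (metis open_Compl closed_singleton)
    have cont: "continuous_on (cball x r) (f j)" for j
      unfolding f_def using r(2) by (intro continuous_intros) auto
    have "continuous_on (cball x r) B"
      unfolding B_def using r(2) by (intro continuous_intros) auto
    then obtain C where C: "\<And>z. z \<in> cball x r \<Longrightarrow> B z \<le> C"
      using compact_continuous_image[of "cball x r" B] compact_imp_bounded[of "B ` cball x r"]
      by (metis bounded_real abs_le_D1 compact_cball imageI)
    have "uniformly_convergent_on (cball x r) (\<lambda>N z. \<Sum>n<N. norm (f n z - 1))"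
    proof (rule Weierstrass_m_test'[OF _ geo[of C]])
      fix n z assume "z \<in> cball x r"
      then have "B z * q ^ n \<le> C * q ^ n"
        using C q by (intro mult_right_mono) auto
      with le[of n z] show "norm (norm (f n z - 1)) \<le> C * q ^ n"
        by simp
    qed
    then have "uniformly_convergent_on (cball x r) (\<lambda>N z. \<Prod>n<N. f n z)"
      by (intro uniformly_convergent_on_prod' cont) auto
    then obtain l where l: "uniform_limit (cball x r) (\<lambda>N z. \<Prod>n<N. f n z) l sequentially"
      by (auto simp: uniformly_convergent_on_def)
    have "l z = prodinf (\<lambda>j. f j z)" if "z \<in> cball x r" for z
    proof (rule LIMSEQ_unique)
      show "(\<lambda>N. \<Prod>n<N. f n z) \<longlonglongrightarrow> l z"
        using tendsto_uniform_limitI[OF l that] .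
      show "(\<lambda>N. \<Prod>n<N. f n z) \<longlonglongrightarrow> prodinf (\<lambda>j. f j z)"
        using convergent_prod_LIMSEQ[OF abs_convergent_prod_imp_convergent_prod[OF conv[of z]]]
        by (subst filterlim_sequentially_Suc[symmetric]) (simp add: lessThan_Suc_atMost)
    qed
    with l have "uniform_limit (cball x r) (\<lambda>N z. \<Prod>n<N. f n z) (\<lambda>z. prodinf (\<lambda>j. f j z)) sequentially"
      by (metis (mono_tags, lifting) uniform_limit_cong')
    with r show "\<exists>d>0. cball x d \<subseteq> -{0} \<and>
        uniform_limit (cball x d) (\<lambda>n z. \<Prod>j<n. f j z) (\<lambda>z. prodinf (\<lambda>j. f j z)) sequentially"
      by blast
  qed auto
qed

lemma gauss_meromorphic:
  assumes "0 < q" "q < 1"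
  shows "gauss q e meromorphic_on -{0}"
proof -
  have "(\<lambda>z. prodinf (\<lambda>j. (1 - e * z * q ^ j) * (1 - e * inverse z * q ^ j))) analytic_on -{0}"
    using gauss_denominator(2)[OF assms] by (subst analytic_on_open) auto
  then show ?thesis
    unfolding gauss_def[abs_def]
    by (intro meromorphic_on_divide meromorphic_on_const analytic_on_imp_meromorphic_on)
qed

end

theory Submission
  imports Defs
begin

text \<open>
  Write \<open>h = G\<^sub>c / G\<^sub>e\<close> with \<open>e = q / d\<close>, and \<open>k = 1 / h\<close>.  Conjugation by the multiplication
  operator \<open>h(Z)\<close> is multiplicative on operators, so it suffices to follow what it does to the
  generators.  It fixes \<open>Z\<close> because multiplications commute, and it fixes \<open>T\<^sub>1\<close> because Gaussians
  are invariant under \<open>z \<mapsto> 1 / z\<close>, so \<open>h\<close> passes through both terms of the divided difference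
  (\<open>T1_op_conjugate\<close>).

  The operator \<open>T\<^sub>0\<close> involves the other reflection, \<open>z \<mapsto> q / z\<close>.  From
  \<open>(x; q)\<^sub>\<infinity> = (1 - x) (q x; q)\<^sub>\<infinity>\<close> the Gaussian picks up a rational factor there
  (\<open>gauss_refl_q\<close>), and the factors of \<open>G\<^sub>c\<close> and \<open>G\<^sub>e\<close> combine to
  \<open>h(z) k(q / z) = (q - cz)(q - dz) / (q (c - z)(d - z))\<close>.
  Conjugation thus replaces \<open>(c - z)(d - z)\<close> in the coefficient of \<open>f(q / z)\<close> by
  \<open>(q - cz)(q - dz) / q\<close>, which is \<open>q\<^sup>-\<^sup>1cd (q / d - z)(q / c - z)\<close>: the coefficient occurring in
  \<open>q\<^sup>-\<^sup>1cd T\<^sub>0(q / d, q / c)\<close>.  The coefficients of \<open>f(z)\<close> then agree by a polynomial identity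
  (\<open>T0_conjugate_alg\<close>).

  For \<open>Y\<close> and \<open>D\<close> it remains to compute \<open>t\<^sub>4\<close>.  Clearly \<open>Y\<close> goes to \<open>\<kappa> Y\<close> with
  \<open>\<kappa> = q\<^sup>-\<^sup>1cd\<close>, hence \<open>Y\<^sup>-\<^sup>1\<close> goes to \<open>\<kappa>\<^sup>-\<^sup>1 Y\<^sup>-\<^sup>1\<close>; since the factor \<open>q\<^sup>-\<^sup>1abcd\<close> in \<open>D\<close> is
  \<open>ab \<kappa>\<close> and for the new parameters \<open>ab \<kappa>\<^sup>-\<^sup>1\<close>, also \<open>D\<close> goes to \<open>\<kappa> D\<close>.
\<close>

section \<open>The shifted factorial\<close>

text \<open>The infinite \<open>q\<close>-shifted factorial \<open>(x; q)\<^sub>\<infinity>\<close>.\<close>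

definition qpoch :: "real \<Rightarrow> complex \<Rightarrow> complex" where
  "qpoch q x = prodinf (\<lambda>j. 1 - x * complex_of_real q ^ j)"

lemma qpoch_has_prod:
  assumes "0 < q" "q < 1"
  shows "(\<lambda>j. 1 - x * complex_of_real q ^ j) has_prod qpoch q x"
proof -
  have "summable (\<lambda>j. norm x * q ^ j)"
    using assms by (intro summable_mult summable_geometric) auto
  then have "abs_convergent_prod (\<lambda>j. 1 - x * complex_of_real q ^ j)"
    using assms by (simp add: abs_convergent_prod_conv_summable norm_mult norm_power)
  then show ?thesis
    unfolding qpoch_def by (intro convergent_prod_has_prod abs_convergent_prod_imp_convergent_prod)
qed

text \<open>A convergent infinite product vanishes only through one of its factors.\<close>

lemma qpoch_eq_0_iff:
  assumes "0 < q" "q < 1"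
  shows "qpoch q x = 0 \<longleftrightarrow> (\<exists>j. x * complex_of_real q ^ j = 1)"
  using has_prod_eq_0_iff[OF qpoch_has_prod[OF assms, of x]] by (auto simp: image_iff)

lemma qpoch_shift:
  assumes "0 < q" "q < 1"
  shows "qpoch q x = (1 - x) * qpoch q (q * x)"
  \<comment> \<open>Shifting the index of a product requires the omitted factor \<open>1 - x\<close> to be nonzero.\<close>
proof (cases "x = 1")
  case True
  then show ?thesis
    using qpoch_eq_0_iff[OF assms, of x] by (auto intro: exI[of _ 0])
next
  case False
  have "(\<lambda>j. 1 - x * complex_of_real q ^ (j + 1)) has_prod qpoch q (q * x)"
    using qpoch_has_prod[OF assms, of "q * x"] by (simp add: algebra_simps)
  then have "(\<lambda>j. 1 - x * complex_of_real q ^ j) has_prod (qpoch q (q * x) * (\<Prod>j<1. 1 - x * complex_of_real q ^ j))"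
    using False by (subst (asm) has_prod_iff_shift) auto
  then show ?thesis
    using has_prod_unique2[OF qpoch_has_prod[OF assms, of x]] by (simp add: mult.commute)
qed

section \<open>The Gaussian under the two reflections\<close>

lemma gauss_qpoch:
  assumes "0 < q" "q < 1"
  shows "gauss q e z = 1 / (qpoch q (e * z) * qpoch q (e * inverse z))"
  using has_prod_mult[OF qpoch_has_prod[OF assms, of "e * z"] qpoch_has_prod[OF assms, of "e * inverse z"]]
  by (simp add: gauss_def has_prod_iff)

lemma gauss_inverse: "gauss q e (inverse z) = gauss q e z"
  by (simp add: gauss_def mult.commute)

text \<open>
  The map \<open>z \<mapsto> q / z\<close> turns the arguments \<open>e z\<close>, \<open>e / z\<close> of the two shifted factorials into
  \<open>q (e / z)\<close> and \<open>q\<^sup>-\<^sup>1 (e z)\<close>.  One product loses its first factor and the other gains one.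
  The nonvanishing hypotheses exclude the default value 0 that the Gaussian takes at a zero of its
  denominator.
\<close>

lemma gauss_refl_q:
  assumes "0 < q" "q < 1" "z \<noteq> 0"
    and "gauss q e z \<noteq> 0" "gauss q e (q * inverse z) \<noteq> 0"
  shows "gauss q e (q * inverse z) * (q - e * z) * z = gauss q e z * (z - e) * q"
proof -
  define w where "w = q * inverse z"
  have w: "inverse z = w / q" "inverse w = z / q" "z * w = q"
    using assms by (auto simp: w_def field_simps)
  have ew: "q * (e * inverse z) = e * w" "q * (e * inverse w) = e * z"
    using assms w by (simp_all add: w(1,2))
  have s: "qpoch q (e * inverse z) = (1 - e * inverse z) * qpoch q (e * w)"
    "qpoch q (e * inverse w) = (1 - e * inverse w) * qpoch q (e * z)"
    using qpoch_shift[OF assms(1,2), of "e * inverse z"] qpoch_shift[OF assms(1,2), of "e * inverse w"]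
    unfolding ew .
  have nz: "qpoch q (e * z) \<noteq> 0" "qpoch q (e * w) \<noteq> 0" "1 - e * inverse z \<noteq> 0" "1 - e * inverse w \<noteq> 0"
    using assms(4,5) unfolding w_def[symmetric] gauss_qpoch[OF assms(1,2)] s by auto
  have v: "z - e = z * (1 - e * inverse z)" "q - e * z = q * (1 - e * inverse w)"
    using assms w by (auto simp: field_simps)
  have "1 / (A * (W * B)) * (q * W) * z = 1 / (B * (V * A)) * (z * V) * q"
    if "A \<noteq> 0" "B \<noteq> 0" "V \<noteq> 0" "W \<noteq> 0" for A B V W :: complex
    using that by (simp add: divide_simps)
  from this[OF nz(2,1,3,4)] show ?thesis
    unfolding gauss_qpoch[OF assms(1,2)] w_def[symmetric] s v .
qed

text \<open>
  At a zero of its denominator the Gaussian has the default value 0, so the claim is that these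
  zeros do not accumulate.  A meromorphic function on a connected domain vanishes almost everywhere
  or almost nowhere, and the first is excluded by counting: every zero of the denominator is
  \<open>e q\<^sup>j\<close> or \<open>1 / (e q\<^sup>j)\<close>.
\<close>

lemma gauss_nonzero:
  assumes "0 < q" "q < 1" "e \<noteq> 0"
  shows "\<forall>\<^sub>\<approx>z\<in>-{0}. gauss q e z \<noteq> 0"
proof (rule ccontr)
  assume "\<not> ?thesis"
  moreover have "connected (-{0::complex})"
    by (intro connected_punctured_universe) simp
  ultimately have "\<forall>\<^sub>\<approx>z\<in>-{0}. gauss q e z = 0"
    using meromorphic_imp_constant_or_avoid[OF gauss_meromorphic[OF assms(1,2)], of e 0] by auto
  then have "countable (-{0} \<inter> {z. gauss q e z \<noteq> 0})"
    by (intro sparse_imp_countable) (auto simp: eventually_cosparse)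
  then have nonzeros: "countable {z \<in> -{0}. gauss q e z \<noteq> 0}"
    by (rule countable_subset[rotated]) auto
  have "{z \<in> -{0}. gauss q e z = 0} \<subseteq>
      range (\<lambda>j. inverse (e * q ^ j)) \<union> range (\<lambda>j. e * q ^ j)"
  proof
    fix z assume "z \<in> {z \<in> -{0}. gauss q e z = 0}"
    then obtain j where "z \<noteq> 0" and "e * z * q ^ j = 1 \<or> e * inverse z * q ^ j = 1"
      by (auto simp: gauss_qpoch[OF assms(1,2)] qpoch_eq_0_iff[OF assms(1,2)])
    then have "z = inverse (e * q ^ j) \<or> z = e * q ^ j"
      using assms by (auto simp: field_simps)
    then show "z \<in> range (\<lambda>j. inverse (e * q ^ j)) \<union> range (\<lambda>j. e * q ^ j)"
      by auto
  qed
  then have zeros: "countable {z \<in> -{0}. gauss q e z = 0}"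
    by (rule countable_subset) auto
  have "countable ({z \<in> -{0}. gauss q e z \<noteq> 0} \<union> {z \<in> -{0}. gauss q e z = 0} \<union> {0})"
    by (intro countable_Un nonzeros zeros countable_insert countable_empty)
  also have "{z \<in> -{0}. gauss q e z \<noteq> 0} \<union> {z \<in> -{0}. gauss q e z = 0} \<union> {0} = UNIV"
    by auto
  finally show False
    using uncountable_UNIV_complex by simp
qed

section \<open>Conjugation of the generators\<close>

lemma mop_mop_inverse:
  assumes "h meromorphic_on -{0}" "k meromorphic_on -{0}" "\<forall>\<^sub>\<approx>z\<in>-{0}. h z * k z = 1"
  shows "mop h (mop k F) = F"
proof -
  have "abs_mero h * abs_mero k = abs_mero (\<lambda>z. h z * k z)"
    using mop_abs[OF assms(1,2)] by (simp add: mop_def)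
  also have "\<dots> = 1"
    unfolding one_mero_def
    by (rule abs_mero_eqI) (use assms in \<open>auto intro!: meromorphic_intros\<close>)
  finally show ?thesis
    by (simp add: mop_def flip: mult.assoc)
qed

lemma mop_commute: "mop h (mop k F) = mop k (mop h F)"
  by (simp add: mop_def mult_ac)

lemma T1_op_conjugate:
  assumes h: "h meromorphic_on -{0}" and k: "k meromorphic_on -{0}"
    and hk: "\<forall>\<^sub>\<approx>z\<in>-{0}. h z * k z = 1" and sym: "\<And>z. k (inverse z) = k z"
  shows "mop h (T1_op a b (mop k F)) = T1_op a b F"
proof -
  obtain f where F: "F = abs_mero f" and f: "f meromorphic_on -{0}"
    by (rule mero_cases)
  note m = f h k meromorphic_on_mult T1_raw_mero
  show ?thesis
    unfolding F
    apply (subst mop_abs T1_op_abs, (intro m)+)+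
    apply (rule abs_mero_eqI, (intro m)+)
    apply (rule eventually_mono[OF hk])
    subgoal premises p for z
    proof -
      have *: "h z * (k z * x) = x" for x
        using p by (simp flip: mult.assoc)
      have "h z * (- a * b * (k z * f z) + r * ((k z * f z - k z * f w) / s))
          = - a * b * (h z * (k z * f z)) + r * ((h z * (k z * f z) - h z * (k z * f w)) / s)" for r s w
        by (simp add: algebra_simps diff_divide_distrib)
      then show ?thesis
        unfolding sym * .
    qed
    done
qed

text \<open>
  The conjugated formula for \<open>T\<^sub>0\<close> at a single point, with \<open>F\<close>, \<open>G\<close> for the values of \<open>f\<close> at
  \<open>z\<close>, \<open>q / z\<close> and \<open>K\<close>, \<open>K'\<close> for those of \<open>k\<close>.  By the hypothesis on \<open>H * K'\<close> the
  coefficients of \<open>G\<close> agree.  Those of \<open>F\<close> agree because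
  \<open>q\<^sup>-\<^sup>1(q - cz)(q - dz) - (c - z)(d - z) = (q\<^sup>-\<^sup>1cd - 1)(z\<^sup>2 - q)\<close>,
  where the last factor cancels the denominator of the divided difference.
\<close>

lemma T0_conjugate_alg:
  fixes q c d c' d' z F G H K K' :: complex
  assumes "q \<noteq> 0" and cd: "c * d' = q" "d * c' = q" and "H * K = 1"
    and r: "q * (c - z) * (d - z) * (H * K') = (q - c * z) * (q - d * z)"
    and "z \<noteq> 0" "z * z \<noteq> q" and p: "p = inverse q"
  shows "H * (- p * c * d * (K * F)
        - inverse z * (c - z) * (d - z) * ((K * F - K' * G) / (z - q * inverse z)))
      = p * c * d * (- p * c' * d' * F
        - inverse z * (c' - z) * (d' - z) * ((F - G) / (z - q * inverse z)))"
proof -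
  define E where "E = 1 / (z * z - q)"
  have E: "x / (z - q * inverse z) = x * z * E" "E * (z * z - q) = 1" for x
    using assms by (auto simp: E_def field_simps)
  have q: "q * p = 1" "z * inverse z = 1"
    using assms by auto
  have HK: "H * (K * x) = x" for x
    using assms(4) by (simp flip: mult.assoc)
  have r': "(c - z) * (d - z) * (H * K') = p * ((q - c * z) * (q - d * z))"
    unfolding r[symmetric] using q by (simp add: mult_ac)
  have 1: "H * (- p * c * d * (K * F) - inverse z * (c - z) * (d - z) * ((K * F - K' * G) * z * E))
      = - p * c * d * F - (c - z) * (d - z) * F * E + p * ((q - c * z) * (q - d * z)) * G * E"
    (is "?lhs = _")
  proof -
    have "?lhs = - p * c * d * (H * (K * F)) - (z * inverse z) * E *
        ((c - z) * (d - z) * (H * (K * F)) - (c - z) * (d - z) * (H * K') * G)"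
      by (simp add: algebra_simps)
    then show ?thesis
      unfolding HK q r' by (simp add: algebra_simps)
  qed
  have cd': "c * d * ((c' - z) * (d' - z)) = (q - c * z) * (q - d * z)"
  proof -
    have "c * d * ((c' - z) * (d' - z)) = (c * d' - c * z) * (d * c' - d * z)"
      by (simp add: algebra_simps)
    then show ?thesis
      by (simp add: cd)
  qed
  have pq: "p * p * (c * d') * (d * c') = 1"
  proof -
    have "p * p * (c * d') * (d * c') = (q * p) * (q * p)"
      by (simp add: cd)
    then show ?thesis
      by (simp add: q)
  qed
  have 2: "p * c * d * (- p * c' * d' * F - inverse z * (c' - z) * (d' - z) * ((F - G) * z * E))
      = - F - p * ((q - c * z) * (q - d * z)) * (F - G) * E"
    (is "?lhs = _")
  proof -
    have "?lhs = - (p * p * (c * d') * (d * c')) * F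
        - (z * inverse z) * E * (p * (c * d * ((c' - z) * (d' - z))) * (F - G))"
      by (simp add: algebra_simps)
    then show ?thesis
      unfolding pq q cd' by (simp add: algebra_simps)
  qed
  have "p * ((q - c * z) * (q - d * z)) = (q * p) * q - (q * p) * (c + d) * z + p * c * d * z * z"
    by (simp add: algebra_simps)
  also have "\<dots> - (c - z) * (d - z) = (p * c * d - 1) * (z * z - q) + (q * p - 1) * (q - (c + d) * z + c * d)"
    by (simp add: algebra_simps)
  finally have "p * ((q - c * z) * (q - d * z)) - (c - z) * (d - z) = (p * c * d - 1) * (z * z - q)"
    by (simp add: q)
  then have "(p * ((q - c * z) * (q - d * z)) - (c - z) * (d - z)) * E = (p * c * d - 1) * (E * (z * z - q))"
    by simp
  then have "(p * ((q - c * z) * (q - d * z)) - (c - z) * (d - z)) * E = p * c * d - 1"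
    unfolding E(2) by simp
  moreover have "- p * c * d * F - M * F * E + N * G * E - (- F - N * (F - G) * E)
      = ((N - M) * E - (p * c * d - 1)) * F" for M N
    by (simp add: algebra_simps)
  ultimately show ?thesis
    unfolding E 1 2 by (metis right_minus_eq mult_zero_left)
qed

text \<open>Of the multiplier \<open>h\<close> only its change \<open>h(z) / h(q / z)\<close> under the reflection enters.\<close>

lemma T0_op_conjugate:
  fixes q :: real and c d c' d' :: complex
  assumes q: "q \<noteq> 0" and h: "h meromorphic_on -{0}" and k: "k meromorphic_on -{0}"
    and hk: "\<forall>\<^sub>\<approx>z\<in>-{0}. h z * k z = 1"
    and ratio: "\<forall>\<^sub>\<approx>z\<in>-{0::complex}. q * (c - z) * (d - z) * (h z * k (q * inverse z)) = (q - c * z) * (q - d * z)"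
    and cd: "c * d' = q" "d * c' = q"
  shows "mop h (T0_op q c d (mop k F)) = smul (inverse q * c * d) (T0_op q c' d' F)"
proof -
  obtain f where F: "F = abs_mero f" and f: "f meromorphic_on -{0}"
    by (rule mero_cases)
  have q': "complex_of_real q \<noteq> 0" using q by simp
  note m = f h k meromorphic_on_mult meromorphic_on_const T0_raw_mero q'
  have ev: "\<forall>\<^sub>\<approx>z\<in>-{0::complex}. (h z * k z = 1 \<and>
      q * (c - z) * (d - z) * (h z * k (q * inverse z)) = (q - c * z) * (q - d * z)) \<and> z \<noteq> 0 \<and> z * z \<noteq> q"
    by (intro eventually_conj[OF eventually_conj[OF hk ratio] eventually_sq_neq])
  show ?thesis
    unfolding F
    apply (subst mop_abs smul_abs T0_op_abs[OF _ q], (intro m)+)+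
    apply (rule abs_mero_eqI, (intro m)+)
    apply (rule eventually_mono[OF ev])
    apply (elim conjE)
    apply (subst T0_conjugate_alg[OF q' cd]; (assumption | simp)?)
    done
qed

section \<open>From generators to the whole algebra\<close>

text \<open>
  Between any two letters of a word \<open>k(Z) h(Z) = 1\<close> may be inserted, so that the conjugate of a
  product is the product of the conjugates.
\<close>

lemma free_rep_t4_free:
  assumes gen: "\<And>g F. mop h (gen_op q a b c d g (mop k F)) = free_rep q a b c' d' (t4_gen q c d g) F"
    and hk: "\<And>F. mop h (mop k F) = F"
  shows "mop h (free_rep q a b c d u (mop k F)) = free_rep q a b c' d' (t4_free q c d u) F"
proof (induction u rule: free_induct)
  case zero
  then show ?case by (simp add: free_rep_simps t4_free_simps mop_def)
next
  case (single w x)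
  have kh: "mop k (mop h F) = F" for F
    using hk mop_commute by metis
  have "mop h (foldr (gen_op q a b c d) gs (mop k F))
      = free_rep q a b c' d' (prod_list (map (t4_gen q c d) gs)) F" for gs
  proof (induction gs)
    case Nil
    then show ?case by (simp add: hk free_rep_simps)
  next
    case (Cons g gs)
    have "mop h (foldr (gen_op q a b c d) (g # gs) (mop k F))
        = mop h (gen_op q a b c d g (mop k (mop h (foldr (gen_op q a b c d) gs (mop k F)))))"
      by (simp add: kh)
    then show ?case
      by (simp add: gen Cons free_rep_mult)
  qed
  then show ?case
    by (simp add: free_rep_single t4_free_single free_rep_mult free_rep_simps mop_linear)
next
  case (add u v)
  then show ?case by (simp add: free_rep_add t4_free_add mop_linear)
qed

section \<open>Residue classes\<close>

lemma carrier_daha: "carrier (daha q a b c d) = range (daha_cls q a b c d)"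
  by (auto simp: daha_def daha_cls_def[abs_def] FactRing_def A_RCOSETS_def')

lemma daha_cls_ops:
  "daha_cls q a b c d u \<otimes>\<^bsub>daha q a b c d\<^esub> daha_cls q a b c d v = daha_cls q a b c d (u * v)"
  "daha_cls q a b c d u \<oplus>\<^bsub>daha q a b c d\<^esub> daha_cls q a b c d v = daha_cls q a b c d (u + v)"
  "\<one>\<^bsub>daha q a b c d\<^esub> = daha_cls q a b c d 1"
  using ideal.rcoset_mult_add[OF daha_ideal_ideal, of u v q a b c d]
    ideal.a_rcos_sum[OF daha_ideal_ideal, of u v q a b c d]
  by (simp_all add: daha_def daha_cls_def FactRing_def)

lemma inv_daha_cls:
  assumes "daha_cls q a b c d (u * v) = daha_cls q a b c d 1"
    and "daha_cls q a b c d (v * u) = daha_cls q a b c d 1"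
  shows "inv\<^bsub>daha q a b c d\<^esub> (daha_cls q a b c d u) = daha_cls q a b c d v"
proof -
  have "Ring.ring (daha q a b c d)"
    unfolding daha_def by (rule ideal.quotient_is_ring[OF daha_ideal_ideal])
  then have "monoid (daha q a b c d)"
    by (rule Ring.ring.is_monoid)
  from monoid.inv_unique'[OF this, of "daha_cls q a b c d u" "daha_cls q a b c d v"] show ?thesis
    using assms by (simp add: carrier_daha daha_cls_ops)
qed

text \<open>
  The inverse of a generator \<open>g\<close> modulo the relation \<open>(g + k) (g + 1) = 0\<close>, which reads
  \<open>g (g + 1 + k) = - k\<close>.
\<close>

definition quad_inv :: "complex \<Rightarrow> gen \<Rightarrow> free" where
  "quad_inv k g = scal (- inverse k) * (gn g + scal (1 + k))"

lemma quad_inv_mult: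
  assumes "k \<noteq> 0"
  shows "gn g * quad_inv k g - 1 = scal (- inverse k) * ((gn g + scal k) * (gn g + 1))"
    and "quad_inv k g * gn g = gn g * quad_inv k g"
proof -
  have *: "u * (scal x * v) = scal x * (u * v)" for u v x
    using scal_comm[of u x] by (simp flip: mult.assoc)
  have "1 + scal (- 1) = 0"
    using scal_simps(3)[of 1 "- 1"] by (simp add: scal_simps(1,2))
  then have "scal (- 1) = - 1"
    by (simp add: add_eq_0_iff)
  then have k: "scal (- inverse k) * scal k = - 1"
    using assms by (simp flip: scal_simps(4))
  show "gn g * quad_inv k g - 1 = scal (- inverse k) * ((gn g + scal k) * (gn g + 1))"
    unfolding quad_inv_def * by (simp add: distrib_left distrib_right k scal_simps(2,3) scal_comm[of "gn g"])
  show "quad_inv k g * gn g = gn g * quad_inv k g"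
    unfolding quad_inv_def * by (simp add: distrib_left distrib_right scal_comm[of "gn g"] mult.assoc)
qed

text \<open>
  Representatives of \<open>Y\<close>, its inverse and \<open>D\<close> in the free algebra.  They allow \<open>t\<^sub>4\<close> to be computed
  by substitution, with equalities that hold before passing to residue classes.
\<close>

definition Y_free :: free where
  "Y_free = gn gT1 * gn gT0"

definition Y_inv_free :: "real \<Rightarrow> complex \<Rightarrow> complex \<Rightarrow> complex \<Rightarrow> complex \<Rightarrow> free" where
  "Y_inv_free q a b c d = quad_inv (inverse q * c * d) gT0 * quad_inv (a * b) gT1"

definition D_free :: "real \<Rightarrow> complex \<Rightarrow> complex \<Rightarrow> complex \<Rightarrow> complex \<Rightarrow> free" where
  "D_free q a b c d = Y_free + scal (inverse q * a * b * c * d) * Y_inv_free q a b c d"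

lemma daha_Y_cls: "daha_Y q a b c d = daha_cls q a b c d Y_free"
  by (simp add: daha_Y_def daha_cls_ops Y_free_def)

lemma daha_D_cls:
  assumes "q \<noteq> 0" "a \<noteq> 0" "b \<noteq> 0" "c \<noteq> 0" "d \<noteq> 0"
  shows "daha_D q a b c d = daha_cls q a b c d (D_free q a b c d)"
proof -
  let ?I = "daha_ideal q a b c d"
  note I = daha_idealD[where q = q and a = a and b = b and c = c and d = d]
  define x1 x0 where "x1 = quad_inv (a * b) gT1" and "x0 = quad_inv (inverse q * c * d) gT0"
  have rel: "(gn gT1 + scal (a * b)) * (gn gT1 + 1) \<in> ?I"
      "(gn gT0 + scal (inverse q * c * d)) * (gn gT0 + 1) \<in> ?I"
    using I(6) by (auto simp: daha_rels_def)
  have r1: "gn gT1 * x1 - 1 \<in> ?I"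
    unfolding x1_def by (subst quad_inv_mult) (use assms in \<open>auto intro!: I(4) rel\<close>)
  have r0: "gn gT0 * x0 - 1 \<in> ?I"
    unfolding x0_def using assms rel(2) by (subst quad_inv_mult) (auto intro!: I(4))
  have l: "x1 * gn gT1 = gn gT1 * x1" "x0 * gn gT0 = gn gT0 * x0"
    unfolding x1_def x0_def using assms by (auto intro!: quad_inv_mult)
  have Y: "Y_free * (x0 * x1) - 1 = gn gT1 * (gn gT0 * x0 - 1) * x1 + (gn gT1 * x1 - 1)"
    by (simp add: Y_free_def algebra_simps)
  have 1: "Y_free * (x0 * x1) - 1 \<in> ?I"
    unfolding Y by (rule I(2)[OF I(5)[OF I(4)[OF r0]] r1])
  have Y': "x0 * x1 * Y_free - 1 = x0 * (x1 * gn gT1 - 1) * gn gT0 + (x0 * gn gT0 - 1)"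
    by (simp add: Y_free_def algebra_simps)
  have 2: "x0 * x1 * Y_free - 1 \<in> ?I"
    unfolding Y' l by (rule I(2)[OF I(5)[OF I(4)[OF r1]] r0])
  have "inv\<^bsub>daha q a b c d\<^esub> (daha_cls q a b c d Y_free) = daha_cls q a b c d (Y_inv_free q a b c d)"
    using 1 2 by (intro inv_daha_cls) (simp_all add: daha_cls_eq Y_inv_free_def x0_def x1_def)
  then show ?thesis
    by (simp add: daha_D_def daha_Y_cls daha_cls_ops D_free_def)
qed

lemma t4_free_Y_free: "t4_free q c d Y_free = scal (inverse (of_real q) * c * d) * Y_free"
  using scal_comm[of "gn gT1" "inverse (of_real q) * c * d"]
  by (simp add: Y_free_def t4_free_mult t4_free_simps t4_gen_def flip: mult.assoc)

text \<open>
  The substitution takes the representative of \<open>T\<^sub>0\<^sup>-\<^sup>1\<close> to a multiple of the one for the new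
  parameters because \<open>\<kappa> = q\<^sup>-\<^sup>1cd\<close> becomes \<open>\<kappa>\<^sup>-\<^sup>1\<close> when \<open>(c, d)\<close> is replaced by
  \<open>(q / d, q / c)\<close>.
\<close>

lemma t4_free_D_free:
  assumes "q \<noteq> 0" "c \<noteq> 0" "d \<noteq> 0"
  shows "t4_free q c d (D_free q a b c d) = scal (inverse (of_real q) * c * d) * D_free q a b (q / d) (q / c)"
proof -
  define k where "k = inverse (of_real q) * c * d"
  have k: "k \<noteq> 0" "inverse (of_real q) * (q / d) * (q / c) = inverse k"
    using assms by (auto simp: k_def field_simps)
  have 0: "t4_free q c d (quad_inv k gT0) = scal (inverse k) * quad_inv (inverse k) gT0"
  proof -
    have "t4_free q c d (gn gT0) = scal k * gn gT0"
      by (simp add: t4_free_simps t4_gen_def k_def)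
    moreover have "- inverse k * k = inverse k * - inverse (inverse k)"
      "- inverse k * (1 + k) = inverse k * - inverse (inverse k) * (1 + inverse k)"
      using k(1) by (simp_all add: field_simps)
    ultimately show ?thesis
      by (simp only: quad_inv_def t4_free_mult t4_free_add t4_free_simps(1) distrib_left
          flip: mult.assoc scal_simps(4))
  qed
  have 1: "t4_free q c d (quad_inv l gT1) = quad_inv l gT1" for l
    by (simp add: quad_inv_def t4_free_mult t4_free_add t4_free_simps t4_gen_def)
  have ab: "inverse (of_real q) * a * b * c * d * inverse k = a * b" "k * (inverse (of_real q) * a * b * (q / d) * (q / c)) = a * b"
    using assms by (auto simp: k_def field_simps)
  have scal_scal: "scal x * (scal y * u) = scal (x * y) * u" for x y u
    by (simp add: scal_simps(4) mult.assoc)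
  have "t4_free q c d (D_free q a b c d)
      = scal k * Y_free + scal (inverse (of_real q) * a * b * c * d) *
          (scal (inverse k) * quad_inv (inverse k) gT0 * quad_inv (a * b) gT1)"
    unfolding D_free_def Y_inv_free_def t4_free_add t4_free_mult t4_free_simps t4_free_Y_free
      k_def[symmetric] 0 1 by (rule refl)
  also have "\<dots> = scal k * Y_free + scal k * (scal (inverse (of_real q) * a * b * (q / d) * (q / c)) *
          (quad_inv (inverse k) gT0 * quad_inv (a * b) gT1))"
    by (simp only: mult.assoc[of "scal (inverse k)"] scal_scal ab)
  finally show ?thesis
    by (simp only: D_free_def Y_inv_free_def k(2) k_def[symmetric] distrib_left)
qed

section \<open>The gauge transformation\<close>

theorem lemma4p4:
  fixes q :: real and a b c d :: complex
  assumes "0 < q" and "q < 1"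
    and "a \<noteq> 0" and "b \<noteq> 0" and "c \<noteq> 0" and "d \<noteq> 0"
    and "generic a b c d"
  shows
    "(\<forall>U \<in> carrier (daha q a b c d).
        mop (\<lambda>z. gauss q c z / gauss q (q / d) z) \<circ> basic_rep q a b c d U
          \<circ> mop (\<lambda>z. gauss q (q / d) z / gauss q c z)
        = basic_rep q a b (q / d) (q / c) (t4 q a b c d U)) \<and>
     mop (\<lambda>z. gauss q c z / gauss q (q / d) z) \<circ> T0_op q c d
        \<circ> mop (\<lambda>z. gauss q (q / d) z / gauss q c z)
      = opsmul (inverse q * c * d) (T0_op q (q / d) (q / c)) \<and>
     mop (\<lambda>z. gauss q c z / gauss q (q / d) z) \<circ> basic_rep q a b c d (daha_Y q a b c d)
        \<circ> mop (\<lambda>z. gauss q (q / d) z / gauss q c z)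
      = opsmul (inverse q * c * d)
          (basic_rep q a b (q / d) (q / c) (daha_Y q a b (q / d) (q / c))) \<and>
     mop (\<lambda>z. gauss q c z / gauss q (q / d) z) \<circ> basic_rep q a b c d (daha_D q a b c d)
        \<circ> mop (\<lambda>z. gauss q (q / d) z / gauss q c z)
      = opsmul (inverse q * c * d)
          (basic_rep q a b (q / d) (q / c) (daha_D q a b (q / d) (q / c)))"
proof -
  define h where "h = (\<lambda>z. gauss q c z / gauss q (q / d) z)"
  define k where "k = (\<lambda>z. gauss q (q / d) z / gauss q c z)"
  define A where "A = free_rep q a b c d"
  define B where "B = free_rep q a b (q / d) (q / c)"
  have q: "q \<noteq> 0" using assms(1) by simp
  have mero: "h meromorphic_on -{0}" "k meromorphic_on -{0}"
    unfolding h_def k_def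
    by (intro meromorphic_on_divide gauss_meromorphic assms(1,2))+
  have nz: "\<forall>\<^sub>\<approx>z\<in>-{0}. gauss q c z \<noteq> 0 \<and> gauss q (q / d) z \<noteq> 0"
    using assms by (intro eventually_conj gauss_nonzero) auto
  have hk: "\<forall>\<^sub>\<approx>z\<in>-{0}. h z * k z = 1"
    by (rule eventually_mono[OF nz]) (simp add: h_def k_def)
  have sym: "k (inverse z) = k z" for z
    by (simp add: k_def gauss_inverse)
  \<comment> \<open>The reflection formula is needed for both Gaussians, with nonzero values at \<open>z\<close> and \<open>q / z\<close>.\<close>
  have nz': "\<forall>\<^sub>\<approx>z\<in>-{0::complex}. (gauss q c z \<noteq> 0 \<and> gauss q (q / d) z \<noteq> 0)
      \<and> (gauss q c (q / z) \<noteq> 0 \<and> gauss q (q / d) (q / z) \<noteq> 0) \<and> z \<noteq> 0 \<and> z * z \<noteq> 0"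
    using cosparse_compose[OF nz, of q] assms(1)
    by (intro eventually_conj[OF nz] eventually_conj[OF _ eventually_sq_neq]) auto
  have ratio: "\<forall>\<^sub>\<approx>z\<in>-{0::complex}. q * (c - z) * (d - z) * (h z * k (q * inverse z)) = (q - c * z) * (q - d * z)"
  proof (rule eventually_mono[OF nz'], goal_cases)
    case (1 z)
    define A A' B B' where "A = gauss q c z" and "A' = gauss q c (q * inverse z)"
      and "B = gauss q (q / d) z" and "B' = gauss q (q / d) (q * inverse z)"
    have ne: "A \<noteq> 0" "A' \<noteq> 0" "B \<noteq> 0" "B' \<noteq> 0" "z \<noteq> 0"
      using 1 by (auto simp: A_def A'_def B_def B'_def divide_inverse)
    have A: "A' * (q - c * z) * z = A * (z - c) * q"
      using gauss_refl_q[of q z c] assms ne by (simp add: A_def A'_def)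
    have "B' * (q - q / d * z) * z = B * (z - q / d) * q"
      using gauss_refl_q[of q z "q / d"] assms ne by (simp add: B_def B'_def)
    moreover have "q - q / d * z = q / d * (d - z)" "(z - q / d) * q = q / d * (d * z - q)"
      using assms by (simp_all add: field_simps)
    ultimately have B: "B' * (d - z) * z = B * (d * z - q)"
      using assms by (simp add: mult.assoc mult.left_commute[of _ "q / d"])
    have "q * (c - z) * (d - z) * (A * B') * z = - (A * (z - c) * q) * (B' * (d - z) * z)"
      by (simp add: algebra_simps)
    also have "\<dots> = (q - c * z) * (q - d * z) * (B * A') * z"
      unfolding A[symmetric] B by (simp add: algebra_simps)
    finally have "q * (c - z) * (d - z) * (A * B') = (q - c * z) * (q - d * z) * (B * A')"
      using ne by simp
    then have "q * (c - z) * (d - z) * (A / B * (B' / A')) = (q - c * z) * (q - d * z)"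
      using ne by (simp add: divide_simps)
    then show ?case
      by (simp only: h_def k_def A_def A'_def B_def B'_def)
  qed
  have T0: "mop h (T0_op q c d (mop k F)) = smul (inverse q * c * d) (T0_op q (q / d) (q / c) F)" for F
    by (rule T0_op_conjugate[OF q mero hk ratio]) (use assms in auto)
  have hk_id: "mop h (mop k F) = F" for F
    by (rule mop_mop_inverse[OF mero hk])
  have "mop h (gen_op q a b c d g (mop k F)) = B (t4_gen q c d g) F" for g F
  proof (cases g)
    case gT1
    then show ?thesis
      by (simp add: B_def t4_gen_def free_rep_simps T1_op_conjugate[OF mero hk sym])
  next
    case gT0
    then show ?thesis
      by (simp add: B_def t4_gen_def free_rep_simps free_rep_mult T0)
  next
    case gZ
    then show ?thesis
      by (simp add: B_def t4_gen_def free_rep_simps mop_commute[of h "\<lambda>z. z"] hk_id)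
  next
    case gZi
    then show ?thesis
      by (simp add: B_def t4_gen_def free_rep_simps mop_commute[of h inverse] hk_id)
  qed
  then have conj: "mop h (A u (mop k F)) = B (t4_free q c d u) F" for u F
    unfolding A_def B_def by (intro free_rep_t4_free hk_id)
  have cls: "basic_rep q a b c d (daha_cls q a b c d u) = A u"
    "basic_rep q a b (q / d) (q / c) (daha_cls q a b (q / d) (q / c) u) = B u" for u
    unfolding A_def B_def by (intro basic_rep_cls q)+
  have scal: "B (scal x * u) = opsmul x (B u)" for x u
    by (auto simp: B_def opsmul_def free_rep_mult free_rep_simps)
  have D': "daha_D q a b (q / d) (q / c) = daha_cls q a b (q / d) (q / c) (D_free q a b (q / d) (q / c))"
    using assms by (intro daha_D_cls) auto
  show ?thesis
    unfolding h_def[symmetric] k_def[symmetric]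
  proof (intro conjI ballI ext)
    fix U F assume "U \<in> carrier (daha q a b c d)"
    then obtain u where "U = daha_cls q a b c d u"
      by (auto simp: carrier_daha)
    then show "(mop h \<circ> basic_rep q a b c d U \<circ> mop k) F
        = basic_rep q a b (q / d) (q / c) (t4 q a b c d U) F"
      using assms q by (simp add: t4_cls cls conj)
  next
    show "(mop h \<circ> T0_op q c d \<circ> mop k) F = opsmul (inverse q * c * d) (T0_op q (q / d) (q / c)) F" for F
      by (simp add: T0 opsmul_def)
  next
    show "(mop h \<circ> basic_rep q a b c d (daha_Y q a b c d) \<circ> mop k) F
        = opsmul (inverse q * c * d) (basic_rep q a b (q / d) (q / c) (daha_Y q a b (q / d) (q / c))) F" for F
      by (simp only: o_apply daha_Y_cls cls conj t4_free_Y_free scal of_real_inverse)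
  next
    show "(mop h \<circ> basic_rep q a b c d (daha_D q a b c d) \<circ> mop k) F
        = opsmul (inverse q * c * d) (basic_rep q a b (q / d) (q / c) (daha_D q a b (q / d) (q / c))) F" for F
      by (simp only: o_apply daha_D_cls[OF q assms(3-6)] D' cls conj t4_free_D_free[OF q assms(5,6)] scal
          of_real_inverse)
  qed
qed

end
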